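(* Let $\Gamma$ be a countable group acting without inversion on a non-trivial tree. If the vertex stabilizers are icc and the edge stabilizers are finite, then $\Gamma$ admits a faithful and highly transitive action on an infinite countable set.
   Context: Graphs and trees are in the sense of Serre: each edge $e$ has a source $s(e)$, a range $r(e)$ and an inverse edge $\overline{e}\neq e$ with $\overline{\overline{e}}=e$, $s(\overline{e})=r(e)$. A group acts without inversion if no group element maps an edge $e$ to $\overline{e}$. A tree is called non-trivial if it has at least two edges, $e$ and its inverse edge $\overline{e}$. A group $H$ is called icc if for every $g\in H\setminus\{1\}$ the conjugacy class $\{hgh^{-1}: h\in H\}$ is infinite. An action of a countable group $\Gamma$ on an infinite countable set $X$ is highly transitive if it is $n$-transitive for all $n\geq 1$, i.e. for any pairwise distinct $x_1,\dots,x_n\in X$ and any pairwise distinct $y_1,\dots,y_n\in X$ there is $g\in\Gamma$ with $gx_k=y_k$ for all $1\le k\le n$. An action is faithful if only $1\in \Gamma$ acts as the identity.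
   Formalization: Icc groups are additionally required to be infinite, so trivial vertex stabilizers are excluded; otherwise the claim is false, e.g. for the trivial group acting on a single edge or the integers translating a line. *)

theory Defs
  imports
    "HOL-Algebra.Group_Action"
    "HOL-Library.Countable_Set"
    "Graph_Theory.Bidirected_Digraph"
    "Graph_Theory.Digraph_Component"
begin

text \<open>
  A graph in the sense of Serre is a \<^locale>\<open>bidirected_digraph\<close>: the source and range maps are
  \<^term>\<open>tail T\<close> and \<^term>\<open>head T\<close>, and the inversion \<^term>\<open>bar\<close> is a fixed-point free
  involution of the arcs.  Outside the arc set, that locale requires \<^term>\<open>bar\<close> to be the identity.

  Each arc and its inverse form a \<^const>\<open>pre_digraph.cycle\<close> of length 2, so the library's
  \<^const>\<open>tree\<close> does not apply here.  A circuit in the sense of Serre is a cycle that never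
  traverses an arc and then immediately its inverse. (Such a cycle cannot backtrack at its
  base point either, since its vertices are distinct.)
\<close>

definition circuit :: "('v, 'e) pre_digraph \<Rightarrow> ('e \<Rightarrow> 'e) \<Rightarrow> 'e list \<Rightarrow> bool" where
  "circuit T bar p \<longleftrightarrow> pre_digraph.cycle T p \<and> successively (\<lambda>e f. f \<noteq> bar e) p"

text \<open>
  Since arcs come with their inverses, connectedness is the existence of a directed path between
  any two vertices; \<^const>\<open>strongly_connected\<close> also includes non-emptiness.
\<close>

locale serre_tree = bidirected_digraph T bar
  for T :: "('v, 'e) pre_digraph" and bar :: "'e \<Rightarrow> 'e" +
  assumes conn: "strongly_connected T"
    and no_circuit: "\<not> circuit T bar p"

definition nontrivial_graph :: "('v, 'e) pre_digraph \<Rightarrow> bool" where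
  "nontrivial_graph T \<longleftrightarrow> (\<exists>e \<in> arcs T. \<exists>f \<in> arcs T. e \<noteq> f)"

locale serre_graph_action =
  bidirected_digraph T bar +
  vertex: group_action G "verts T" \<phi> +
  edge: group_action G "arcs T" \<psi>
  for G :: "('g, 'm) monoid_scheme"
    and T :: "('v, 'e) pre_digraph" and bar :: "'e \<Rightarrow> 'e"
    and \<phi> :: "'g \<Rightarrow> 'v \<Rightarrow> 'v" and \<psi> :: "'g \<Rightarrow> 'e \<Rightarrow> 'e" +
  assumes tail_act: "\<lbrakk> g \<in> carrier G; e \<in> arcs T \<rbrakk> \<Longrightarrow> tail T (\<psi> g e) = \<phi> g (tail T e)"
    and head_act: "\<lbrakk> g \<in> carrier G; e \<in> arcs T \<rbrakk> \<Longrightarrow> head T (\<psi> g e) = \<phi> g (head T e)"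
    and bar_act: "\<lbrakk> g \<in> carrier G; e \<in> arcs T \<rbrakk> \<Longrightarrow> \<psi> g (bar e) = bar (\<psi> g e)"

definition without_inversion ::
  "('g, 'm) monoid_scheme \<Rightarrow> ('v, 'e) pre_digraph \<Rightarrow> ('e \<Rightarrow> 'e) \<Rightarrow> ('g \<Rightarrow> 'e \<Rightarrow> 'e) \<Rightarrow> bool" where
  "without_inversion G T bar \<psi> \<longleftrightarrow> (\<forall>g \<in> carrier G. \<forall>e \<in> arcs T. \<psi> g e \<noteq> bar e)"

text \<open>
  As usual, an icc group is required to be infinite.  Given the condition on conjugacy classes,
  this only excludes the trivial group, for which that condition is vacuous.  Without this
  convention the trivial group acting on a single edge, or the integers acting on a line by
  translations, would have icc vertex stabilizers.
\<close>

definition icc :: "('g, 'm) monoid_scheme \<Rightarrow> bool" where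
  "icc H \<longleftrightarrow> infinite (carrier H) \<and>
    (\<forall>g \<in> carrier H - {\<one>\<^bsub>H\<^esub>}.
       infinite {h \<otimes>\<^bsub>H\<^esub> g \<otimes>\<^bsub>H\<^esub> inv\<^bsub>H\<^esub> h | h. h \<in> carrier H})"

definition n_transitive ::
  "nat \<Rightarrow> ('g, 'm) monoid_scheme \<Rightarrow> 'x set \<Rightarrow> ('g \<Rightarrow> 'x \<Rightarrow> 'x) \<Rightarrow> bool" where
  "n_transitive n G X \<alpha> \<longleftrightarrow>
    (\<forall>xs ys. length xs = n \<and> distinct xs \<and> set xs \<subseteq> X \<and>
             length ys = n \<and> distinct ys \<and> set ys \<subseteq> X \<longrightarrow>
       (\<exists>g \<in> carrier G. \<forall>k < n. \<alpha> g (xs ! k) = ys ! k))"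

definition highly_transitive ::
  "('g, 'm) monoid_scheme \<Rightarrow> 'x set \<Rightarrow> ('g \<Rightarrow> 'x \<Rightarrow> 'x) \<Rightarrow> bool" where
  "highly_transitive G X \<alpha> \<longleftrightarrow> (\<forall>n \<ge> 1. n_transitive n G X \<alpha>)"

end

(*
  The action is left translation on the cosets of a subgroup H, the union of an increasing
  sequence of finitely generated subgroups acting freely on the vertices of the tree.  Given such
  a subgroup K and two tuples of distinct K-cosets a_i K and b_i K, one adds all the elements
  b_i^-1 g a_i for a single suitable g.  Since K acts cocompactly and freely on an invariant
  subtree, K-orbits leave a vertex v in finitely many directions only, while the stabilizer of v
  moves an edge at v in infinitely many ways.  B. H. Neumann's lemma and the icc property then
  yield an element g whose geodesics from v to g v and to g^-1 v start in directions so generic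
  that the half-trees of the added elements play ping-pong with K: the new group is the free
  product of K and a free group, still acts freely on the vertices, and avoids any finite set
  prescribed outside K.  The prescribed elements include, for each nontrivial element of the
  group, a conjugate outside K, which makes the final action faithful.
*)

theory Submission
  imports Defs "HOL-Algebra.Generated_Groups"
begin

section \<open>Geodesics and half-trees\<close>

text \<open>Freeness on the vertices is the invariant of the construction because it makes the
  conditions on g finite. Besides bounding the directions, it leaves only finitely many elements x
  of the sets p K q^-1, with p and q among the a_i and b_i, that fix v. These are the obstacle: if a
  nontrivial one fixes a chosen edge at v, or carries one chosen edge to the other, two half-trees
  that ping-pong needs disjoint coincide. Infinite vertex stabilizers alone would not remove it: a
  finite normal subgroup of the stabilizer of v that fixes an edge also fixes all translates of that
  edge under the stabilizer. Under icc the nontrivial elements of the finite edge stabilizer have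
  infinite conjugacy classes, so their conjugates can be kept off any finite set.

  The element g has the form c k d^-1. Here k turns v about a neighbour, so that k v and k^-1 v lie
  beyond the same edge, while c and d fix v and choose independently the first edges towards g v and
  g^-1 v.\<close>

context serre_tree
begin

abbreviation reduced :: "'e list \<Rightarrow> bool" where
  "reduced \<equiv> successively (\<lambda>e f. f \<noteq> bar e)"

abbreviation reverse_walk :: "'e list \<Rightarrow> 'e list" where
  "reverse_walk p \<equiv> rev (map bar p)"

text \<open>A shortest counterexample would be a circuit: if a vertex repeats after the first edge,
  the walk between the two visits is again closed, reduced and nonempty, and it is shorter.\<close>

lemma closed_reduced_walk_Nil:
  "awalk u p u \<Longrightarrow> reduced p \<Longrightarrow> p = []"
proof (induction "length p" arbitrary: u p rule: less_induct)
  case less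
  show ?case
  proof (rule ccontr)
    assume "p \<noteq> []"
    then obtain e p' where p: "p = e # p'" by (cases p) auto
    have "\<not> cycle p"
      using no_circuit[of p] less.prems(2) by (simp add: circuit_def)
    then have "\<not> distinct (awalk_verts (head T e) p')"
      using less.prems(1) p by (auto simp: cycle_def)
    moreover have "awalk (head T e) p' u"
      using less.prems(1) unfolding p awalk_Cons_iff by blast
    ultimately obtain q r s w where qrs: "p' = q @ r @ s" "0 < length r" "awalk w r w"
      by (metis awalk_not_distinct_decomp)
    have "reduced r"
      using less.prems(2) p qrs(1) by (auto simp: successively_append_iff successively_Cons)
    then show False
      using less.hyps[of r w] p qrs by auto
  qed
qed

lemma awalk_reverse_walk: "awalk u p w \<Longrightarrow> awalk w (reverse_walk p) u"
proof (induction p arbitrary: u)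
  case Nil
  then show ?case by (auto simp: awalk_Nil_iff)
next
  case (Cons e p)
  then have "awalk w (reverse_walk p) (head T e)" and e: "e \<in> arcs T" "u = tail T e"
    by (auto simp: awalk_Cons_iff)
  moreover have "awalk (head T e) [bar e] u"
    using e by (simp add: awalk_simps)
  ultimately show ?case
    using awalk_appendI by fastforce
qed

lemma reduced_reverse_walk: "reduced (reverse_walk p) \<longleftrightarrow> reduced p"
  by (auto simp: successively_map intro: successively_mono)

text \<open>If the first edges differ, the reverse of \<open>q\<close> followed by \<open>p\<close>
  does not backtrack at \<open>u\<close>, the only place where it could, and is a nonempty closed
  reduced walk.\<close>

lemma reduced_walk_unique:
  "awalk u p w \<Longrightarrow> reduced p \<Longrightarrow> awalk u q w \<Longrightarrow> reduced q \<Longrightarrow> p = q"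
proof (induction p arbitrary: u q)
  case Nil
  then have "u = w" by (simp add: awalk_Nil_iff)
  then show ?case using Nil closed_reduced_walk_Nil by metis
next
  case (Cons e p)
  show ?case
  proof (cases q)
    case Nil
    then have "u = w" using Cons by (simp add: awalk_Nil_iff)
    then show ?thesis using Cons closed_reduced_walk_Nil by metis
  next
    case q: (Cons f q')
    show ?thesis
    proof (cases "e = f")
      case True
      then show ?thesis
        using Cons q by (auto simp: awalk_Cons_iff successively_Cons)
    next
      case False
      have "awalk w (reverse_walk q @ (e # p)) w"
        using awalk_appendI[OF awalk_reverse_walk[OF Cons.prems(3)] Cons.prems(1)] by simp
      moreover have "reduced (reverse_walk q @ (e # p))"
        using Cons.prems(2,4) False q reduced_reverse_walk[of q]
        by (auto simp: successively_append_iff)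
      ultimately have "reverse_walk q @ (e # p) = []"
        by (rule closed_reduced_walk_Nil)
      then show ?thesis by simp
    qed
  qed
qed

definition geo :: "'v \<Rightarrow> 'v \<Rightarrow> 'e list" where
  "geo u w = (THE p. awalk u p w \<and> reduced p)"

lemma geo_eqI: "awalk u p w \<Longrightarrow> reduced p \<Longrightarrow> geo u w = p"
  unfolding geo_def using reduced_walk_unique by blast

text \<open>Prepending an edge to a reduced walk cancels at most the first edge of that walk, so
  every walk can be reduced without new edges. The inclusion allows geodesics to be bounded by
  arbitrary walks, as in \<open>set_geo_triangle\<close>.\<close>

lemma awalk_imp_geo:
  "awalk u p w \<Longrightarrow> awalk u (geo u w) w \<and> reduced (geo u w) \<and> set (geo u w) \<subseteq> set p"
proof (induction p arbitrary: u)
  case Nil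
  then have "geo u w = []" by (intro geo_eqI) auto
  then show ?case using Nil by simp
next
  case (Cons e p)
  let ?q = "geo (head T e) w"
  have e: "e \<in> arcs T" "u = tail T e" using Cons.prems by (auto simp: awalk_Cons_iff)
  have IH: "awalk (head T e) ?q w" "reduced ?q" "set ?q \<subseteq> set p"
    using Cons by (auto simp: awalk_Cons_iff)
  show ?case
  proof (cases "?q \<noteq> [] \<and> hd ?q = bar e")
    case True
    then obtain q where q: "?q = bar e # q" by (cases ?q) auto
    then have "awalk u q w" "reduced q"
      using IH e by (auto simp: awalk_Cons_iff successively_Cons)
    then have "geo u w = q" by (rule geo_eqI)
    then show ?thesis using \<open>awalk u q w\<close> \<open>reduced q\<close> q IH(3) by auto
  next
    case False
    then have "awalk u (e # ?q) w" "reduced (e # ?q)"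
      using IH e by (auto simp: awalk_Cons_iff successively_Cons)
    then have "geo u w = e # ?q" by (rule geo_eqI)
    then show ?thesis using \<open>awalk u (e # ?q) w\<close> \<open>reduced (e # ?q)\<close> IH(3) by auto
  qed
qed

lemma geo:
  assumes "u \<in> verts T" "w \<in> verts T"
  shows awalk_geo: "awalk u (geo u w) w" and reduced_geo: "reduced (geo u w)"
proof -
  obtain p where "awalk u p w"
    using conn assms by (metis reachable_awalk strongly_connected_def)
  then show "awalk u (geo u w) w" "reduced (geo u w)"
    using awalk_imp_geo by blast+
qed

lemma set_geo_triangle:
  assumes "x \<in> verts T" "y \<in> verts T" "z \<in> verts T"
  shows "set (geo x z) \<subseteq> set (geo x y) \<union> set (geo y z)"
  using awalk_imp_geo[OF awalk_appendI[OF awalk_geo awalk_geo]] assms by fastforce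

lemma set_geo: "u \<in> verts T \<Longrightarrow> w \<in> verts T \<Longrightarrow> set (geo u w) \<subseteq> arcs T"
  using awalk_geo by blast

lemma geo_reverse: "u \<in> verts T \<Longrightarrow> w \<in> verts T \<Longrightarrow> geo w u = reverse_walk (geo u w)"
  using geo reduced_reverse_walk by (metis geo_eqI awalk_reverse_walk)

lemma geo_Nil_iff: "u \<in> verts T \<Longrightarrow> w \<in> verts T \<Longrightarrow> geo u w = [] \<longleftrightarrow> u = w"
  using awalk_geo by (metis awalk_Nil_iff geo_eqI successively.simps(1))

lemma tail_hd_geo:
  assumes "u \<in> verts T" "w \<in> verts T" "geo u w \<noteq> []"
  shows "hd (geo u w) \<in> arcs T" "tail T (hd (geo u w)) = u"
  using awalk_geo[OF assms(1,2)] assms(3) by (cases "geo u w"; simp add: awalk_Cons_iff)+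

text \<open>For an arc, this is the component of \<open>head T e\<close> after removal of
  \<open>e\<close> and \<open>bar e\<close>.\<close>

definition half_tree :: "'e \<Rightarrow> 'v set" where
  "half_tree e = {w \<in> verts T. geo (tail T e) w \<noteq> [] \<and> hd (geo (tail T e) w) = e}"

lemma half_tree_verts: "half_tree e \<subseteq> verts T"
  by (auto simp: half_tree_def)

lemma tail_notin_half_tree: "e \<in> arcs T \<Longrightarrow> tail T e \<notin> half_tree e"
  by (auto simp: half_tree_def geo_Nil_iff)

text \<open>The geodesic from \<open>tail T e\<close> back to \<open>u\<close> does not start with
  \<open>e\<close>, so the two geodesics are joined at \<open>tail T e\<close> without
  backtracking.\<close>

lemma geo_through_tail:
  assumes e: "e \<in> arcs T" and w: "w \<in> half_tree e" and u: "u \<in> verts T" "u \<notin> half_tree e"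
  shows "geo u w = geo u (tail T e) @ geo (tail T e) w"
proof (rule geo_eqI)
  let ?a = "tail T e"
  have V: "?a \<in> verts T" "w \<in> verts T" using e w by (auto simp: half_tree_def)
  show "awalk u (geo u ?a @ geo ?a w) w"
    using awalk_appendI awalk_geo V u(1) by blast
  have "hd (geo ?a w) \<noteq> bar (last (geo u ?a))" if "geo u ?a \<noteq> []"
  proof -
    have revw: "geo ?a u = reverse_walk (geo u ?a)" using geo_reverse[OF u(1) V(1)] .
    then have "geo ?a u \<noteq> []" using that by (metis Nil_is_map_conv Nil_is_rev_conv)
    moreover have "hd (geo ?a u) = bar (last (geo u ?a))"
      unfolding revw hd_rev using that by (rule last_map)
    ultimately show ?thesis using u w by (auto simp: half_tree_def)
  qed
  then show "reduced (geo u ?a @ geo ?a w)"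
    using reduced_geo V u(1) by (auto simp: successively_append_iff)
qed

text \<open>For a common point \<open>w\<close>, each tail lies on the geodesic from the other tail
  to \<open>w\<close>. Comparing lengths, the tails coincide, and a single geodesic would start with
  both \<open>e\<close> and \<open>f\<close>.\<close>

lemma half_trees_disjoint:
  assumes "e \<in> arcs T" "f \<in> arcs T" "e \<noteq> f"
    and "tail T e \<notin> half_tree f" "tail T f \<notin> half_tree e"
  shows "half_tree e \<inter> half_tree f = {}"
proof (rule ccontr)
  assume "half_tree e \<inter> half_tree f \<noteq> {}"
  then obtain w where w: "w \<in> half_tree e" "w \<in> half_tree f" by blast
  have "length (geo (tail T e) w) = length (geo (tail T e) (tail T f)) + length (geo (tail T f) w)"
    using geo_through_tail[OF assms(2) w(2) _ assms(4)] assms(1) by simp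
  moreover have "length (geo (tail T f) w) = length (geo (tail T f) (tail T e)) + length (geo (tail T e) w)"
    using geo_through_tail[OF assms(1) w(1) _ assms(5)] assms(2) by simp
  ultimately have "geo (tail T e) (tail T f) = []" by simp
  then have "tail T e = tail T f" using assms(1,2) by (simp add: geo_Nil_iff)
  then show False using w assms(3) by (auto simp: half_tree_def)
qed

end

lemma (in group) mult_inv_cancel_left:
  assumes "x \<in> carrier G" "y \<in> carrier G"
  shows "x \<otimes> (inv x \<otimes> y) = y" "inv x \<otimes> (x \<otimes> y) = y"
  using assms by (simp_all add: m_assoc[symmetric])

section \<open>Finite unions of cosets\<close>

text \<open>
  B. H. Neumann's lemma: a group is not a finite union of cosets of subgroups of infinite index.
  The set of \<open>k\<close> with \<open>act k y = z\<close> is empty or a coset of the stabilizer of \<open>y\<close>, so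
  infinite orbits replace infinite index.
\<close>

lemma (in group) act_avoids_finite_sets:
  fixes act :: "'a \<Rightarrow> 'y \<Rightarrow> 'y"
  assumes "finite I"
    and "\<And>k l y. \<lbrakk> k \<in> carrier G; l \<in> carrier G; y \<in> I \<rbrakk> \<Longrightarrow> act (k \<otimes> l) y = act k (act l y)"
    and "\<And>y. y \<in> I \<Longrightarrow> finite (Z y)"
    and "\<And>y. y \<in> I \<Longrightarrow> infinite ((\<lambda>k. act k y) ` carrier G)"
  shows "\<exists>k \<in> carrier G. \<forall>y \<in> I. act k y \<notin> Z y"
  using assms
proof (induction I arbitrary: Z rule: finite_induct)
  case empty
  then show ?case by auto
next
  case (insert j I)
  note mult = insert.prems(1)
  have "\<not> (\<lambda>k. act k j) ` carrier G \<subseteq> Z j"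
    using insert.prems(2,3)[of j] finite_subset by blast
  then obtain k0 where k0: "k0 \<in> carrier G" "act k0 j \<notin> Z j" by blast
  \<comment> \<open>\<open>\<kappa> z\<close> carries \<open>j\<close> to \<open>z\<close> whenever
    \<open>z\<close> is in the orbit. An element that avoids the sets for \<open>I\<close> but moves
    \<open>j\<close> to \<open>z\<close> in \<open>Z j\<close> will be corrected by the left factor
    \<open>k0 \<otimes> inv (\<kappa> z)\<close>; the sets added in \<open>Z'\<close> ensure that
    the correction spoils nothing on \<open>I\<close>.\<close>
  define \<kappa> where "\<kappa> z = (SOME k. k \<in> carrier G \<and> act k j = z)" for z
  define Z' where "Z' y = Z y \<union> (\<Union>z \<in> Z j. act (\<kappa> z \<otimes> inv k0) ` Z y)" for y
  have "\<exists>k \<in> carrier G. \<forall>y \<in> I. act k y \<notin> Z' y"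
  proof (rule insert.IH)
    show "finite (Z' y)" if "y \<in> I" for y
      using insert.prems(2) that unfolding Z'_def by blast
  qed (use insert.prems in auto)
  then obtain k where k: "k \<in> carrier G" "\<And>y. y \<in> I \<Longrightarrow> act k y \<notin> Z' y" by blast
  show ?case
  proof (rule ccontr)
    assume neg: "\<not> ?thesis"
    then have kj: "act k j \<in> Z j"
      using k unfolding Z'_def by blast
    define l where "l = \<kappa> (act k j)"
    have l: "l \<in> carrier G" "act l j = act k j"
      unfolding l_def \<kappa>_def
      using someI[of "\<lambda>m. m \<in> carrier G \<and> act m j = act k j", OF conjI[OF k(1) refl]] by auto
    \<comment> \<open>Since \<open>k\<close> and \<open>l\<close> agree at \<open>j\<close>, the
      element \<open>m\<close> acts on \<open>j\<close> as \<open>k0\<close> does.\<close>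
    define m where "m = k0 \<otimes> inv l \<otimes> k"
    have m: "m \<in> carrier G" using k0 l k by (simp add: m_def)
    have "act m j = act (k0 \<otimes> inv l) (act k j)"
      using mult[of "k0 \<otimes> inv l" k j] k0 l k by (simp add: m_def)
    also have "\<dots> = act (k0 \<otimes> inv l \<otimes> l) j"
      using mult[of "k0 \<otimes> inv l" l j] k0 l by simp
    also have "\<dots> = act k0 j"
      using k0 l by (simp add: m_assoc)
    finally have "act m j \<notin> Z j" using k0 by simp
    then obtain y where y: "y \<in> I" "act m y \<in> Z y"
      using neg m by blast
    have "act (l \<otimes> inv k0) (act m y) = act (l \<otimes> inv k0 \<otimes> m) y"
      using mult[of "l \<otimes> inv k0" m y] k0 l m y by simp
    also have "l \<otimes> inv k0 \<otimes> m = k"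
    proof -
      show ?thesis
        using k0(1) l(1) k(1) by (simp add: m_def m_assoc mult_inv_cancel_left)
    qed
    finally have "act k y \<in> act (l \<otimes> inv k0) ` Z y" using y by (metis imageI)
    then have "act k y \<in> Z' y" using kj unfolding Z'_def l_def by blast
    then show False using k(2) y(1) by blast
  qed
qed

section \<open>Ping-pong for a free product\<close>

text \<open>
  The assumptions force the subgroup generated by \<open>H\<close> and the letters \<open>t j\<close> to be the free
  product of \<open>H\<close> and a free group.
\<close>

locale ping_pong = group G + group_action G V \<phi>
  for G (structure) and V :: "'v set" and \<phi> +
  fixes H :: "'a set" and J :: "'j set" and \<tau> :: "'j \<Rightarrow> 'j"
    and t :: "'j \<Rightarrow> 'a" and U :: "'j \<Rightarrow> 'v set"
  assumes H: "subgroup H G"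
    and \<tau>_closed: "j \<in> J \<Longrightarrow> \<tau> j \<in> J" and \<tau>_\<tau>: "j \<in> J \<Longrightarrow> \<tau> (\<tau> j) = j" and \<tau>_neq: "j \<in> J \<Longrightarrow> \<tau> j \<noteq> j"
    and t_closed: "j \<in> J \<Longrightarrow> t j \<in> carrier G" and t_\<tau>: "j \<in> J \<Longrightarrow> t (\<tau> j) = inv (t j)"
    and U_subset: "j \<in> J \<Longrightarrow> U j \<subseteq> V"
    and play: "\<lbrakk> j \<in> J; x \<in> V; x \<notin> U (\<tau> j) \<rbrakk> \<Longrightarrow> \<phi> (t j) x \<in> U j"
    and disj: "\<lbrakk> h \<in> H; l \<in> J; m \<in> J; h \<noteq> \<one> \<or> l \<noteq> m \<rbrakk> \<Longrightarrow> \<phi> h ` U l \<inter> U m = {}"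
begin

section \<open>Reduced words and normal forms\<close>

primrec val :: "('j \<times> 'a) list \<Rightarrow> 'a" where
  "val [] = \<one>"
| "val (x # L) = t (fst x) \<otimes> snd x \<otimes> val L"

text \<open>A normal form in the free product of \<open>H\<close> and a free group, without its
  leading factor from \<open>H\<close>. The only forbidden pattern is a letter, the identity of
  \<open>H\<close>, and the inverse letter.\<close>

definition red :: "('j \<times> 'a) list \<Rightarrow> bool" where
  "red L \<longleftrightarrow> set L \<subseteq> J \<times> H \<and> successively (\<lambda>x y. snd x \<noteq> \<one> \<or> fst y \<noteq> \<tau> (fst x)) L"

lemma H_carrier: "h \<in> H \<Longrightarrow> h \<in> carrier G"
  by (rule subgroup.mem_carrier[OF H])

lemma H_m_inv: "h \<in> H \<Longrightarrow> inv h \<in> H"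
  by (rule subgroup.m_inv_closed[OF H])

lemma H_mult: "h \<in> H \<Longrightarrow> k \<in> H \<Longrightarrow> h \<otimes> k \<in> H"
  by (rule subgroup.m_closed[OF H])

lemma val_closed: "set L \<subseteq> J \<times> H \<Longrightarrow> val L \<in> carrier G"
  by (induction L) (auto simp: t_closed H_carrier)

lemma val_append:
  "set L \<subseteq> J \<times> H \<Longrightarrow> set M \<subseteq> J \<times> H \<Longrightarrow> val (L @ M) = val L \<otimes> val M"
  by (induction L) (auto simp: val_closed t_closed H_carrier m_assoc)

definition normal_forms :: "'a set" where
  "normal_forms = {h \<otimes> val L | h L. h \<in> H \<and> red L}"

lemma normal_formsI: "h \<in> H \<Longrightarrow> red L \<Longrightarrow> h \<otimes> val L \<in> normal_forms"
  by (auto simp: normal_forms_def)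

lemma normal_forms_carrier: "n \<in> normal_forms \<Longrightarrow> n \<in> carrier G"
  by (auto simp: normal_forms_def red_def H_carrier val_closed)

lemma H_mult_normal_forms:
  assumes "h \<in> H" "n \<in> normal_forms"
  shows "h \<otimes> n \<in> normal_forms"
proof -
  obtain k L where n: "k \<in> H" "red L" "n = k \<otimes> val L" using assms by (auto simp: normal_forms_def)
  then have "h \<otimes> n = (h \<otimes> k) \<otimes> val L"
    using assms(1) by (simp add: H_carrier val_closed red_def m_assoc)
  moreover have "h \<otimes> k \<in> H" using assms(1) n(1) by (rule H_mult)
  ultimately show ?thesis using n(2) by (simp add: normal_formsI)
qed

lemma t_mult_normal_forms:
  assumes j: "j \<in> J" and "n \<in> normal_forms"
  shows "t j \<otimes> n \<in> normal_forms"
proof -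
  obtain h L where n: "h \<in> H" "red L" "n = h \<otimes> val L" using assms by (auto simp: normal_forms_def)
  have L: "val L \<in> carrier G" using n(2) by (simp add: val_closed red_def)
  show ?thesis
  proof (cases "L \<noteq> [] \<and> h = \<one> \<and> fst (hd L) = \<tau> j")
    case True
    then obtain k M where M: "L = (\<tau> j, k) # M" by (cases L) auto
    then have k: "k \<in> H" "red M" "k \<in> carrier G" "val M \<in> carrier G"
      using n(2) by (auto simp: red_def successively_Cons H_carrier val_closed)
    have "t j \<otimes> n = t j \<otimes> (inv (t j) \<otimes> (k \<otimes> val M))"
      using n(3) M True j k by (simp add: t_\<tau> t_closed m_assoc)
    also have "\<dots> = k \<otimes> val M"
      using j k by (simp add: t_closed m_assoc[symmetric])
    finally show ?thesis using k normal_formsI by simp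
  next
    case False
    then have "red ((j, h) # L)" using n j by (auto simp: red_def successively_Cons)
    moreover have "t j \<otimes> n = \<one> \<otimes> val ((j, h) # L)"
      using n j L by (simp add: t_closed H_carrier m_assoc)
    ultimately show ?thesis using normal_formsI subgroup.one_closed[OF H] by metis
  qed
qed

lemma generate_subset_normal_forms:
  assumes K: "K \<subseteq> H \<union> t ` J" and "w \<in> generate G K"
  shows "w \<in> normal_forms"
proof -
  \<comment> \<open>Preserving normal forms under left multiplication passes to products at once,
    whereas multiplying two normal forms would require a cancellation of unbounded length.\<close>
  have "w \<in> carrier G \<and> (\<forall>n \<in> normal_forms. w \<otimes> n \<in> normal_forms)"
    using assms(2)
  proof (induction rule: generate.induct)
    case one
    then show ?case by (auto simp: normal_forms_carrier)
  next
    case (incl h)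
    then have "h \<in> H \<or> h \<in> t ` J" using K by blast
    then show ?case
      by (auto intro: H_mult_normal_forms t_mult_normal_forms H_carrier t_closed)
  next
    case (inv h)
    then have "h \<in> H \<or> h \<in> t ` J" using K by blast
    then show ?case
    proof
      assume "h \<in> H"
      then have "inv h \<in> H" by (rule H_m_inv)
      then show ?thesis by (auto intro: H_mult_normal_forms H_carrier)
    next
      assume "h \<in> t ` J"
      then obtain j where "j \<in> J" "h = t j" by blast
      then have "inv h = t (\<tau> j)" "\<tau> j \<in> J" by (simp_all add: t_\<tau> \<tau>_closed)
      then show ?thesis by (auto intro: t_mult_normal_forms t_closed)
    qed
  next
    case (eng h1 h2)
    then show ?case by (auto simp: m_assoc normal_forms_carrier)
  qed
  moreover have "\<one> \<in> normal_forms"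
    using normal_formsI[OF subgroup.one_closed[OF H], of "[]"] by (simp add: red_def)
  ultimately show ?thesis by fastforce
qed

text \<open>Reading the word from the right, each letter throws the point into its own set, and by
  \<open>disj\<close> the factor from \<open>H\<close> before it takes the point off the one set on
  which the next letter is not controlled. The condition in \<open>red\<close> is precisely the side
  condition of \<open>disj\<close>.\<close>

lemma val_play:
  assumes "red L" "L \<noteq> []" "x \<in> V" "\<phi> (snd (last L)) x \<notin> U (\<tau> (fst (last L)))"
  shows "\<phi> (val L) x \<in> U (fst (hd L))"
  using assms
proof (induction L)
  case Nil
  then show ?case by simp
next
  case (Cons a L)
  obtain j h where a: "a = (j, h)" by (cases a)
  have j: "j \<in> J" and h: "h \<in> H" "h \<in> carrier G"
    using Cons.prems(1) a by (auto simp: red_def H_carrier)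
  have L: "red L" "val L \<in> carrier G" 
    using Cons.prems(1) by (auto simp: red_def successively_Cons val_closed)
  define y where "y = \<phi> (val L) x"
  have y: "y \<in> V" using element_image[OF L(2) Cons.prems(3)] by (simp add: y_def)
  have "\<phi> h y \<notin> U (\<tau> j)"
  proof (cases "L = []")
    case True
    have "\<phi> \<one> x = x" using id_eq_one Cons.prems(3) by (metis restrict_apply')
    then show ?thesis using Cons.prems(4) a True by (simp add: y_def)
  next
    case False
    then have "y \<in> U (fst (hd L))" using Cons L by (simp add: y_def)
    moreover have "fst (hd L) \<in> J"
      using False L(1) by (cases L) (auto simp: red_def)
    moreover have "h \<noteq> \<one> \<or> fst (hd L) \<noteq> \<tau> j"
      using Cons.prems(1) False a by (simp add: red_def successively_Cons)
    ultimately show ?thesis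
      using disj[OF h(1), of "fst (hd L)" "\<tau> j"] j \<tau>_closed by blast
  qed
  then have "\<phi> (t j) (\<phi> h y) \<in> U j"
    using play j element_image[OF h(2) y] by blast
  moreover have "\<phi> (val (a # L)) x = \<phi> (t j) (\<phi> h y)"
    using a j h L Cons.prems(3) y by (simp add: y_def composition_rule t_closed)
  ultimately show ?case using a by simp
qed

text \<open>The starting points to which \<open>val_play\<close> applies whatever the last factor
  from \<open>H\<close> is.\<close>

definition outside :: "'v set" where
  "outside = {x \<in> V. \<forall>h \<in> H. \<forall>l \<in> J. \<phi> h x \<notin> U l}"

text \<open>A test for non-membership: an element outside \<open>H\<close> that maps a point of
  \<open>outside\<close> to a point of \<open>outside\<close> cannot be generated.\<close>

lemma generate_play:
  assumes "K \<subseteq> H \<union> t ` J" "w \<in> generate G K" "w \<notin> H" "x \<in> outside"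
  obtains h j where "h \<in> H" "j \<in> J" "\<phi> h (\<phi> w x) \<in> U j"
proof -
  obtain h L where w: "h \<in> H" "red L" "w = h \<otimes> val L"
    using generate_subset_normal_forms[OF assms(1,2)] by (auto simp: normal_forms_def)
  have L: "L \<noteq> []" using w assms(3) by (auto simp: H_carrier)
  then have JH: "fst (last L) \<in> J" "snd (last L) \<in> H" "fst (hd L) \<in> J"
    using w(2) last_in_set[OF L] hd_in_set[OF L] unfolding red_def by (metis mem_Times_iff subsetD)+
  have x: "x \<in> V" using assms(4) by (simp add: outside_def)
  have val: "val L \<in> carrier G" using w by (simp add: val_closed red_def)
  have "\<phi> (val L) x \<in> U (fst (hd L))"
    using val_play[OF w(2) L x] assms(4) JH \<tau>_closed by (auto simp: outside_def)
  moreover have "\<phi> (inv h) (\<phi> w x) = \<phi> (val L) x"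
  proof -
    have "w \<in> carrier G" using w val by (simp add: H_carrier)
    moreover have "inv h \<otimes> w = val L"
      using w val by (simp add: H_carrier m_assoc[symmetric])
    ultimately show ?thesis
      using composition_rule[OF x, of "inv h" w] w(1) by (simp add: H_carrier)
  qed
  moreover have "inv h \<in> H" using w(1) by (rule H_m_inv)
  ultimately show ?thesis using that JH by metis
qed

text \<open>Cyclic reduction. Conjugation by \<open>inv h\<close> moves the leading factor to the
  end of the word. If the last letter then cancels cyclically against the first, conjugation by that
  letter gives a word shorter by two. Otherwise \<open>disj\<close> separates the set of the first
  letter from the forbidden set of the last one, so the word plays ping-pong with itself.\<close>

lemma conj_into_H_or_play_aux:
  "h \<in> H \<Longrightarrow> red L \<Longrightarrow> \<exists>c \<in> carrier G. c \<otimes> (h \<otimes> val L) \<otimes> inv c \<in> H \<or>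
     (\<exists>j \<in> J. \<phi> (c \<otimes> (h \<otimes> val L) \<otimes> inv c) ` U j \<subseteq> U j \<and>
        \<phi> (c \<otimes> (h \<otimes> val L) \<otimes> inv c) ` outside \<subseteq> U j)"
proof (induction "length L" arbitrary: h L rule: less_induct)
  case less
  have h: "h \<in> carrier G" using less.prems by (simp add: H_carrier)
  have val: "val L \<in> carrier G" using less.prems by (simp add: val_closed red_def)
  show ?case
  proof (cases "L = []")
    case True
    then show ?thesis using less.prems h by (intro bexI[of _ \<one>]) simp_all
  next
    case False
    then obtain M j k where L: "L = M @ [(j, k)]" by (metis rev_exhaust surj_pair)
    define L' where "L' = M @ [(j, k \<otimes> h)]"
    have jk: "j \<in> J" "k \<in> H" and M: "set M \<subseteq> J \<times> H" using less.prems L by (auto simp: red_def)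
    have kh: "k \<otimes> h \<in> H" using jk(2) less.prems(1) by (rule H_mult)
    have red': "red L'"
      using less.prems(2) kh unfolding L'_def red_def L
      by (auto simp: successively_append_iff)
    have val': "val L' \<in> carrier G" using red' by (simp add: val_closed red_def)
    have conj: "inv h \<otimes> (h \<otimes> val L) \<otimes> inv (inv h) = val L'"
    proof -
      have "val L' = val L \<otimes> h"
        using M jk kh h unfolding L L'_def
        by (simp add: val_append val_closed H_carrier t_closed m_assoc)
      then show ?thesis using h val by (simp add: m_assoc[symmetric])
    qed
    define i where "i = fst (hd L')"
    have L'ne: "L' \<noteq> []" by (simp add: L'_def)
    have i: "i \<in> J" using red' hd_in_set[OF L'ne] unfolding i_def red_def by (force simp: mem_Times_iff)
    show ?thesis
    proof (cases "k \<otimes> h = \<one> \<and> i = \<tau> j")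
      case True
      \<comment> \<open>In a word with one letter, the first letter is \<open>j\<close> itself,
        which is not its own inverse.\<close>
      then have "M \<noteq> []" using \<tau>_neq[OF jk(1)] by (auto simp: i_def L'_def)
      then obtain l N where N: "M = (\<tau> j, l) # N"
        using True by (cases M) (auto simp: i_def L'_def)
      have l: "l \<in> H" "l \<in> carrier G" and NN: "set N \<subseteq> J \<times> H" using M N by (auto simp: H_carrier)
      have "red N" using red' unfolding L'_def N red_def
        by (auto simp: successively_append_iff successively_Cons)
      moreover have "length N < length L" by (simp add: L N)
      ultimately obtain c where c: "c \<in> carrier G" and
        Q: "c \<otimes> (l \<otimes> val N) \<otimes> inv c \<in> H \<or>
          (\<exists>j \<in> J. \<phi> (c \<otimes> (l \<otimes> val N) \<otimes> inv c) ` U j \<subseteq> U j \<and>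
            \<phi> (c \<otimes> (l \<otimes> val N) \<otimes> inv c) ` outside \<subseteq> U j)"
        using less.hyps[of N l] l(1) by blast
      have tj: "t j \<in> carrier G" using jk by (simp add: t_closed)
      have vN: "val N \<in> carrier G" using NN by (simp add: val_closed)
      have "val L' = inv (t j) \<otimes> (l \<otimes> val N) \<otimes> t j"
        using True jk l(1) NN tj vN l(2) unfolding L'_def N
        by (simp add: val_append t_\<tau> m_assoc \<tau>_closed subgroup.one_closed[OF H])
      then have "t j \<otimes> val L' \<otimes> inv (t j) = l \<otimes> val N"
        using tj vN l(2) by (simp add: m_assoc mult_inv_cancel_left)
      then have lN: "l \<otimes> val N = t j \<otimes> (inv h \<otimes> (h \<otimes> val L) \<otimes> inv (inv h)) \<otimes> inv (t j)"
        unfolding conj by simp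
      have "(c \<otimes> t j \<otimes> inv h) \<otimes> (h \<otimes> val L) \<otimes> inv (c \<otimes> t j \<otimes> inv h) = c \<otimes> (l \<otimes> val N) \<otimes> inv c"
        using c tj h val by (simp add: inv_mult_group m_assoc lN)
      moreover have "c \<otimes> t j \<otimes> inv h \<in> carrier G" using c tj h by simp
      ultimately show ?thesis using Q by metis
    next
      case False
      have "\<phi> (val L') x \<in> U i" if x: "x \<in> U i \<union> outside" for x
      proof -
        have "\<phi> (k \<otimes> h) x \<notin> U (\<tau> j)"
          using x disj[OF kh i \<tau>_closed[OF jk(1)]] False kh \<tau>_closed[OF jk(1)] by (auto simp: outside_def)
        moreover have "x \<in> V" using x U_subset[OF i] by (auto simp: outside_def)
        ultimately show ?thesis
          using val_play[OF red' L'ne] by (simp add: L'_def i_def)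
      qed
      then have "\<phi> (val L') ` U i \<subseteq> U i \<and> \<phi> (val L') ` outside \<subseteq> U i" by blast
      then show ?thesis using i conj h by (intro bexI[of _ "inv h"]) auto
    qed
  qed
qed

lemma conj_into_H_or_play:
  assumes "K \<subseteq> H \<union> t ` J" "w \<in> generate G K"
  obtains (conj) c where "c \<in> carrier G" "c \<otimes> w \<otimes> inv c \<in> H"
  | (play) c j where "c \<in> carrier G" "j \<in> J"
      "\<phi> (c \<otimes> w \<otimes> inv c) ` U j \<subseteq> U j" "\<phi> (c \<otimes> w \<otimes> inv c) ` outside \<subseteq> U j"
proof -
  obtain h L where "h \<in> H" "red L" "w = h \<otimes> val L"
    using generate_subset_normal_forms[OF assms] by (auto simp: normal_forms_def)
  then show ?thesis using conj_into_H_or_play_aux[of h L] that by metis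
qed

end

section \<open>Groups acting on trees\<close>

locale serre_tree_action =
  group G + serre_tree T bar + serre_graph_action G T bar \<phi> \<psi>
  for G :: "('g, 'm) monoid_scheme" (structure)
    and T :: "('v, 'e) pre_digraph" and bar :: "'e \<Rightarrow> 'e"
    and \<phi> :: "'g \<Rightarrow> 'v \<Rightarrow> 'v" and \<psi> :: "'g \<Rightarrow> 'e \<Rightarrow> 'e"
begin

section \<open>Equivariance of geodesics and half-trees\<close>

lemma vertex_act_closed: "g \<in> carrier G \<Longrightarrow> v \<in> verts T \<Longrightarrow> \<phi> g v \<in> verts T"
  using vertex.element_image by blast

lemma edge_act_closed: "g \<in> carrier G \<Longrightarrow> e \<in> arcs T \<Longrightarrow> \<psi> g e \<in> arcs T"
  using edge.element_image by blast

lemma vertex_act_one: "v \<in> verts T \<Longrightarrow> \<phi> \<one> v = v"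
  using vertex.id_eq_one by (metis restrict_apply')

lemma edge_act_one: "e \<in> arcs T \<Longrightarrow> \<psi> \<one> e = e"
  using edge.id_eq_one by (metis restrict_apply')

lemma vertex_act_inv_eq_iff:
  "g \<in> carrier G \<Longrightarrow> v \<in> verts T \<Longrightarrow> w \<in> verts T \<Longrightarrow> \<phi> (inv g) v = w \<longleftrightarrow> v = \<phi> g w"
  using vertex.orbit_sym_aux[of g w v] vertex.orbit_sym_aux[of "inv g" v w] by auto

lemma edge_act_inv_eq_iff:
  "g \<in> carrier G \<Longrightarrow> e \<in> arcs T \<Longrightarrow> f \<in> arcs T \<Longrightarrow> \<psi> (inv g) e = f \<longleftrightarrow> e = \<psi> g f"
  using edge.orbit_sym_aux[of g f e] edge.orbit_sym_aux[of "inv g" e f] by auto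

lemma edge_act_eq_iff:
  "g \<in> carrier G \<Longrightarrow> e \<in> arcs T \<Longrightarrow> f \<in> arcs T \<Longrightarrow> \<psi> g e = \<psi> g f \<longleftrightarrow> e = f"
  using edge.inj_prop inj_on_eq_iff by metis

lemma awalk_act: "g \<in> carrier G \<Longrightarrow> awalk u p w \<Longrightarrow> awalk (\<phi> g u) (map (\<psi> g) p) (\<phi> g w)"
proof (induction p arbitrary: u)
  case Nil
  then show ?case by (auto simp: awalk_Nil_iff vertex_act_closed)
next
  case (Cons e p)
  then have e: "e \<in> arcs T" "u = tail T e" "awalk (head T e) p w" by (auto simp: awalk_Cons_iff)
  then have "awalk (\<phi> g (head T e)) (map (\<psi> g) p) (\<phi> g w)" using Cons by blast
  then show ?case
    using e Cons.prems(1) by (simp add: awalk_Cons_iff edge_act_closed tail_act head_act)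
qed

lemma reduced_act:
  "g \<in> carrier G \<Longrightarrow> set p \<subseteq> arcs T \<Longrightarrow> reduced p \<Longrightarrow> reduced (map (\<psi> g) p)"
proof (induction p)
  case (Cons e p)
  have "hd (map (\<psi> g) p) \<noteq> bar (\<psi> g e)" if "p \<noteq> []"
  proof -
    have "hd p \<in> arcs T" "e \<in> arcs T" "hd p \<noteq> bar e"
      using Cons.prems that hd_in_set by (auto simp: successively_Cons)
    then show ?thesis
      using Cons.prems(1) that bar_act[of g e] edge_act_eq_iff[of g "hd p" "bar e"]
      by (simp add: hd_map)
  qed
  then show ?case using Cons by (auto simp: successively_Cons)
qed simp

lemma geo_act:
  assumes "g \<in> carrier G" "u \<in> verts T" "w \<in> verts T"
  shows "geo (\<phi> g u) (\<phi> g w) = map (\<psi> g) (geo u w)"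
  using assms by (intro geo_eqI awalk_act reduced_act awalk_geo reduced_geo set_geo)

lemma half_tree_act:
  assumes g: "g \<in> carrier G" and e: "e \<in> arcs T" and w: "w \<in> verts T"
  shows "\<phi> g w \<in> half_tree (\<psi> g e) \<longleftrightarrow> w \<in> half_tree e"
proof -
  have "tail T e \<in> verts T" using e by simp
  have "geo (tail T (\<psi> g e)) (\<phi> g w) = map (\<psi> g) (geo (tail T e) w)"
    using geo_act[OF g \<open>tail T e \<in> verts T\<close> w] g e by (simp add: tail_act)
  moreover have "hd (geo (tail T e) w) \<in> arcs T" if "geo (tail T e) w \<noteq> []"
    using tail_hd_geo(1)[OF \<open>tail T e \<in> verts T\<close> w that] .
  ultimately show ?thesis
    using g e w by (auto simp: half_tree_def hd_map edge_act_eq_iff vertex_act_closed)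
qed

lemma half_tree_image:
  assumes g: "g \<in> carrier G" and e: "e \<in> arcs T"
  shows "\<phi> g ` half_tree e = half_tree (\<psi> g e)"
proof
  show "\<phi> g ` half_tree e \<subseteq> half_tree (\<psi> g e)"
    using half_tree_act[OF g e] half_tree_verts by blast
  show "half_tree (\<psi> g e) \<subseteq> \<phi> g ` half_tree e"
  proof
    fix x assume x: "x \<in> half_tree (\<psi> g e)"
    then have "x \<in> verts T" using half_tree_verts by blast
    then obtain w where "w \<in> verts T" "x = \<phi> g w"
      using vertex.surj_prop[OF g] by blast
    then show "x \<in> \<phi> g ` half_tree e" using x half_tree_act[OF g e] by blast
  qed
qed

text \<open>A fixed vertex would be equidistant from \<open>tail T e\<close> and its image. But one
  of these two points lies on the geodesic from the other to the fixed vertex: the image if the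
  vertex is inside the half-tree, the tail if it is outside.\<close>

lemma no_fixed_vertex:
  assumes y: "y \<in> carrier G" and e: "e \<in> arcs T" and u: "u \<in> verts T"
    and sub: "\<phi> y ` half_tree e \<subseteq> half_tree e" and tail: "\<phi> y (tail T e) \<in> half_tree e"
  shows "\<phi> y u \<noteq> u"
proof
  assume fixed: "\<phi> y u = u"
  let ?a = "tail T e"
  have a: "?a \<in> verts T" "\<phi> y ?a \<in> verts T" using e y by (simp_all add: vertex_act_closed)
  have "geo ?a (\<phi> y ?a) = []"
  proof (cases "u \<in> half_tree e")
    case True
    have "u \<in> half_tree (\<psi> y e)" using half_tree_act[OF y e u] fixed True by simp
    moreover have "?a \<notin> half_tree (\<psi> y e)"
      using sub tail_notin_half_tree[OF e] half_tree_image[OF y e] by blast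
    ultimately have "geo ?a u = geo ?a (\<phi> y ?a) @ geo (\<phi> y ?a) u"
      using geo_through_tail[OF edge_act_closed[OF y e]] a y e by (simp add: tail_act)
    moreover have "length (geo (\<phi> y ?a) u) = length (geo ?a u)"
      using geo_act[OF y a(1) u] fixed by simp
    ultimately have "length (geo ?a u) = length (geo ?a (\<phi> y ?a)) + length (geo ?a u)"
      by (metis length_append)
    then show ?thesis by simp
  next
    case False
    have "geo u (\<phi> y ?a) = geo u ?a @ geo ?a (\<phi> y ?a)"
      using geo_through_tail[OF e tail u False] .
    moreover have "length (geo u (\<phi> y ?a)) = length (geo u ?a)"
      using geo_act[OF y u a(1)] fixed by simp
    ultimately have "length (geo u ?a) = length (geo u ?a) + length (geo ?a (\<phi> y ?a))"
      by (metis length_append)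
    then show ?thesis by simp
  qed
  then show False using tail tail_notin_half_tree[OF e] a by (simp add: geo_Nil_iff)
qed

text \<open>The geodesic from \<open>inv g\<close> applied to \<open>tail T e\<close> towards
  \<open>x\<close> passes through \<open>tail T e\<close>, because \<open>x\<close> is not beyond
  \<open>f\<close>. Its image under \<open>g\<close> starts at \<open>tail T e\<close> and passes
  through the image of that vertex, hence starts with \<open>e\<close>.\<close>

lemma half_tree_play:
  assumes g: "g \<in> carrier G"
    and e: "e \<in> arcs T" "\<phi> g (tail T e) \<in> half_tree e"
    and f: "f \<in> arcs T" "tail T f = tail T e" "\<phi> (inv g) (tail T e) \<in> half_tree f"
    and x: "x \<in> verts T" "x \<notin> half_tree f"
  shows "\<phi> g x \<in> half_tree e"
proof -
  let ?v = "tail T e"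
  define w where "w = \<phi> (inv g) ?v"
  have V: "?v \<in> verts T" "w \<in> verts T" using e g by (simp_all add: w_def vertex_act_closed)
  have gw: "\<phi> g w = ?v" using vertex_act_inv_eq_iff[OF g V] by (simp add: w_def)
  have "geo x w = geo x ?v @ geo ?v w"
    using geo_through_tail[OF f(1) _ x] f by (simp add: w_def)
  then have "geo w x = geo w ?v @ geo ?v x"
    unfolding geo_reverse[OF x(1) V(2)] geo_reverse[OF V] geo_reverse[OF x(1) V(1)] by simp
  then have "map (\<psi> g) (geo w x) = map (\<psi> g) (geo w ?v) @ map (\<psi> g) (geo ?v x)" by simp
  then have "geo ?v (\<phi> g x) = geo ?v (\<phi> g ?v) @ map (\<psi> g) (geo ?v x)"
    using geo_act[OF g V(2)] V x gw by metis
  then show ?thesis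
    using e(2) g x by (auto simp: half_tree_def vertex_act_closed)
qed

section \<open>Subgroups acting freely on the vertices\<close>

definition free_on_vertices :: "'g set \<Rightarrow> bool" where
  "free_on_vertices H \<longleftrightarrow> (\<forall>h \<in> H. \<forall>v \<in> verts T. \<phi> h v = v \<longrightarrow> h = \<one>)"

lemma free_on_verticesD:
  "free_on_vertices H \<Longrightarrow> h \<in> H \<Longrightarrow> v \<in> verts T \<Longrightarrow> \<phi> h v = v \<Longrightarrow> h = \<one>"
  by (auto simp: free_on_vertices_def)

lemma free_on_vertices_inj:
  assumes H: "subgroup H G" "free_on_vertices H" and "h \<in> H" "k \<in> H" "v \<in> verts T" "\<phi> h v = \<phi> k v"
  shows "h = k"
proof -
  have c: "h \<in> carrier G" "k \<in> carrier G" using assms(3,4) by (simp_all add: subgroup.mem_carrier[OF H(1)])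
  have "\<phi> (inv k \<otimes> h) v = v"
    using vertex.composition_rule[of v "inv k" h] vertex_act_inv_eq_iff[of k "\<phi> k v" v] c assms(5,6)
    by (simp add: vertex_act_closed)
  moreover have "inv k \<otimes> h \<in> H" using assms by (simp add: subgroup.m_closed subgroup.m_inv_closed)
  ultimately have "inv k \<otimes> h = \<one>" using free_on_verticesD[OF H(2) _ assms(5)] by blast
  then show ?thesis using c mult_inv_cancel_left(1)[of k h] by simp
qed

text \<open>The first edges of the geodesics from \<open>u\<close> to the \<open>H\<close>-orbit of
  \<open>w\<close>.\<close>

definition directions :: "'g set \<Rightarrow> 'v \<Rightarrow> 'v \<Rightarrow> 'e set" where
  "directions H u w = {e \<in> arcs T. tail T e = u \<and> (\<exists>h \<in> H. \<phi> h w \<in> half_tree e)}"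

text \<open>
  The orbit of \<open>w\<close> lies in the union of the \<open>H\<close>-translates of finitely many geodesics, a
  connected subgraph which is locally finite because \<open>H\<close> acts freely on it.
\<close>

lemma finite_directions:
  assumes S: "finite S" "S \<subseteq> carrier G" and free: "free_on_vertices (generate G S)"
    and u: "u \<in> verts T" and w: "w \<in> verts T"
  shows "finite (directions (generate G S) u w)"
proof -
  let ?H = "generate G S"
  have H: "subgroup ?H G" by (rule generate_is_subgroup[OF S(2)])
  \<comment> \<open>Inverses of generators are included because \<open>generate\<close> treats them
    as separate base cases.\<close>
  define E where "E = (\<Union>s \<in> S. set (geo u (\<phi> s u)) \<union> set (geo u (\<phi> (inv s) u))) \<union> set (geo u w)"
  define Y where "Y = {\<psi> h e | h e. h \<in> ?H \<and> e \<in> E}"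
  have "set (geo u (\<phi> s u)) \<subseteq> arcs T" if "s \<in> carrier G" for s
    using that u by (intro set_geo vertex_act_closed)
  then have E: "finite E" "E \<subseteq> arcs T"
    using S set_geo[OF u w] unfolding E_def by (blast, blast intro: inv_closed)
  have "E \<subseteq> Y"
  proof
    fix e assume "e \<in> E"
    moreover from this have "\<psi> \<one> e = e" using E edge_act_one by blast
    ultimately show "e \<in> Y" unfolding Y_def using generate.one[of G S] by force
  qed
  have Hc: "h \<in> ?H \<Longrightarrow> h \<in> carrier G" for h using subgroup.mem_carrier[OF H] .
  have Y_act: "\<psi> h ` Y \<subseteq> Y" if h: "h \<in> ?H" for h
  proof
    fix y assume "y \<in> \<psi> h ` Y"
    then obtain k e where ke: "k \<in> ?H" "e \<in> E" "y = \<psi> h (\<psi> k e)" by (auto simp: Y_def)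
    then have "y = \<psi> (h \<otimes> k) e"
      using edge.composition_rule[of e h k] E(2) Hc h by auto
    then show "y \<in> Y" unfolding Y_def using generate.eng[OF h ke(1)] ke(2) by blast
  qed
  have orbit: "set (geo u (\<phi> h u)) \<subseteq> Y" if "h \<in> ?H" for h
    using that
  proof (induction rule: generate.induct)
    case one
    then show ?case using u geo_Nil_iff[OF u u] by (simp add: vertex_act_one)
  next
    case (incl h)
    then show ?case using \<open>E \<subseteq> Y\<close> unfolding E_def by blast
  next
    case (inv h)
    then show ?case using \<open>E \<subseteq> Y\<close> unfolding E_def by blast
  next
    case (eng h k)
    have c: "h \<in> carrier G" "k \<in> carrier G" using eng Hc by auto
    have "set (geo u (\<phi> (h \<otimes> k) u)) \<subseteq> set (geo u (\<phi> h u)) \<union> set (geo (\<phi> h u) (\<phi> h (\<phi> k u)))"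
      using set_geo_triangle[of u "\<phi> h u" "\<phi> h (\<phi> k u)"] c u
      by (simp add: vertex.composition_rule vertex_act_closed)
    also have "set (geo (\<phi> h u) (\<phi> h (\<phi> k u))) = \<psi> h ` set (geo u (\<phi> k u))"
      using geo_act[of h u "\<phi> k u"] c u by (simp add: vertex_act_closed)
    finally show ?case using eng Y_act by blast
  qed
  have "directions ?H u w \<subseteq> {e \<in> Y. tail T e = u}"
  proof
    fix e assume "e \<in> directions ?H u w"
    then obtain h where e: "e \<in> arcs T" "tail T e = u" and h: "h \<in> ?H" "\<phi> h w \<in> half_tree e"
      by (auto simp: directions_def)
    then have "e \<in> set (geo u (\<phi> h w))" unfolding half_tree_def using hd_in_set by force
    also have "\<dots> \<subseteq> set (geo u (\<phi> h u)) \<union> set (geo (\<phi> h u) (\<phi> h w))"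
      using set_geo_triangle[of u "\<phi> h u" "\<phi> h w"] Hc h(1) u w by (simp add: vertex_act_closed)
    also have "set (geo (\<phi> h u) (\<phi> h w)) = \<psi> h ` set (geo u w)"
      using geo_act[of h u w] Hc h(1) u w by simp
    finally have "e \<in> set (geo u (\<phi> h u)) \<union> \<psi> h ` set (geo u w)" .
    moreover have "set (geo u w) \<subseteq> Y" using \<open>E \<subseteq> Y\<close> unfolding E_def by blast
    ultimately show "e \<in> {e \<in> Y. tail T e = u}" using orbit[OF h(1)] Y_act[OF h(1)] e by blast
  qed
  \<comment> \<open>By freeness at most one element of the subgroup carries \<open>tail T e\<close>
    to \<open>u\<close>, so each arc of \<open>E\<close> has at most one translate starting at
    \<open>u\<close>.\<close>
  moreover have "{e \<in> Y. tail T e = u} \<subseteq> (\<lambda>e. \<psi> (SOME h. h \<in> ?H \<and> \<phi> h (tail T e) = u) e) ` E"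
  proof
    fix y assume "y \<in> {e \<in> Y. tail T e = u}"
    then obtain h e where he: "h \<in> ?H" "e \<in> E" "y = \<psi> h e" "tail T (\<psi> h e) = u" by (auto simp: Y_def)
    have e: "e \<in> arcs T" "tail T e \<in> verts T" using he(2) E(2) by auto
    have he': "h \<in> ?H \<and> \<phi> h (tail T e) = u" using he(1,4) e Hc by (simp add: tail_act)
    have "(SOME h. h \<in> ?H \<and> \<phi> h (tail T e) = u) = h"
      using he' free_on_vertices_inj[OF H free _ _ e(2)] by (intro some_equality) auto
    then show "y \<in> (\<lambda>e. \<psi> (SOME h. h \<in> ?H \<and> \<phi> h (tail T e) = u) e) ` E" using he by force
  qed
  ultimately show ?thesis using E(1) by (meson finite_imageI finite_subset)
qed

section \<open>Vertex and edge stabilizers\<close>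

lemma stabilizer_subgroup: "v \<in> verts T \<Longrightarrow> subgroup (stabilizer G \<phi> v) G"
  by (rule vertex.stabilizer_subgroup)

lemma edge_stabilizer_subset: "e \<in> arcs T \<Longrightarrow> stabilizer G \<psi> e \<subseteq> stabilizer G \<phi> (tail T e)"
  using tail_act by (fastforce simp: stabilizer_def)

lemma infinite_edge_orbit:
  assumes v: "v \<in> verts T" "infinite (stabilizer G \<phi> v)"
    and e: "e \<in> arcs T" "finite (stabilizer G \<psi> e)"
  shows "infinite ((\<lambda>k. \<psi> k e) ` stabilizer G \<phi> v)"
proof
  let ?K = "stabilizer G \<phi> v"
  assume "finite ((\<lambda>k. \<psi> k e) ` ?K)"
  then obtain k where k: "k \<in> ?K" "infinite {l \<in> ?K. \<psi> l e = \<psi> k e}"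
    using pigeonhole_infinite v(2) by blast
  have kc: "k \<in> carrier G" using k(1) by (simp add: stabilizer_def)
  have "{l \<in> ?K. \<psi> l e = \<psi> k e} \<subseteq> (\<lambda>s. k \<otimes> s) ` stabilizer G \<psi> e"
  proof
    fix l assume "l \<in> {l \<in> ?K. \<psi> l e = \<psi> k e}"
    then have l: "l \<in> carrier G" "\<psi> l e = \<psi> k e" by (auto simp: stabilizer_def)
    have "\<psi> (inv k \<otimes> l) e = e"
      using edge.composition_rule[of e "inv k" l] edge_act_inv_eq_iff[of k "\<psi> k e" e] kc l e
      by (simp add: edge_act_closed)
    then have "inv k \<otimes> l \<in> stabilizer G \<psi> e" using kc l by (simp add: stabilizer_def)
    moreover have "l = k \<otimes> (inv k \<otimes> l)" using kc l by (simp add: mult_inv_cancel_left)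
    ultimately show "l \<in> (\<lambda>s. k \<otimes> s) ` stabilizer G \<psi> e" by blast
  qed
  then show False using k(2) e(2) finite_subset by blast
qed

text \<open>If \<open>\<gamma>\<close> moves \<open>v\<close>, let \<open>e\<close> be the first
  edge from \<open>v\<close> towards its image. The conjugate of \<open>\<gamma>\<close> by an
  element \<open>k\<close> fixing \<open>v\<close> moves \<open>v\<close> beyond the translate of
  \<open>e\<close> by \<open>k\<close>. There are infinitely many such translates, but only finitely
  many directions for a finitely generated free subgroup.\<close>

lemma conjugate_outside:
  assumes S: "finite S" "S \<subseteq> carrier G" and free: "free_on_vertices (generate G S)"
    and v: "v \<in> verts T" "infinite (stabilizer G \<phi> v)"
    and edges: "\<And>e. e \<in> arcs T \<Longrightarrow> finite (stabilizer G \<psi> e)"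
    and \<gamma>: "\<gamma> \<in> carrier G" "\<gamma> \<noteq> \<one>"
  shows "\<exists>c \<in> carrier G. c \<otimes> \<gamma> \<otimes> inv c \<notin> generate G S"
proof (cases "\<phi> \<gamma> v = v")
  case True
  then have "\<gamma> \<notin> generate G S" using free_on_verticesD[OF free _ v(1)] \<gamma> by blast
  then show ?thesis using \<gamma> by (intro bexI[of _ \<one>]) auto
next
  case False
  let ?e = "hd (geo v (\<phi> \<gamma> v))"
  have \<gamma>v: "\<phi> \<gamma> v \<in> verts T" using \<gamma> v by (simp add: vertex_act_closed)
  have "geo v (\<phi> \<gamma> v) \<noteq> []" using False geo_Nil_iff[OF v(1) \<gamma>v] by simp
  then have e: "?e \<in> arcs T" "tail T ?e = v" "\<phi> \<gamma> v \<in> half_tree ?e"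
    using tail_hd_geo[OF v(1) \<gamma>v] \<gamma>v by (auto simp: half_tree_def)
  show ?thesis
  proof (rule ccontr)
    assume neg: "\<not> ?thesis"
    have "(\<lambda>k. \<psi> k ?e) ` stabilizer G \<phi> v \<subseteq> directions (generate G S) v v"
    proof
      fix x assume "x \<in> (\<lambda>k. \<psi> k ?e) ` stabilizer G \<phi> v"
      then obtain k where k: "k \<in> carrier G" "\<phi> k v = v" "x = \<psi> k ?e" by (auto simp: stabilizer_def)
      have "\<phi> (k \<otimes> \<gamma> \<otimes> inv k) v = \<phi> k (\<phi> \<gamma> v)"
        using k \<gamma>(1) v(1) \<gamma>v vertex_act_inv_eq_iff[of k v v]
        by (simp add: vertex.composition_rule m_assoc vertex_act_closed)
      then have "\<phi> (k \<otimes> \<gamma> \<otimes> inv k) v \<in> half_tree x"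
        using half_tree_act[OF k(1) e(1) \<gamma>v] e(3) k(3) by simp
      moreover have "k \<otimes> \<gamma> \<otimes> inv k \<in> generate G S" using neg k(1) by blast
      moreover have "x \<in> arcs T" "tail T x = v" using k e by (simp_all add: edge_act_closed tail_act)
      ultimately show "x \<in> directions (generate G S) v v" unfolding directions_def by blast
    qed
    then show False
      using infinite_edge_orbit[OF v e(1) edges[OF e(1)]] finite_directions[OF S free v(1) v(1)]
        finite_subset by blast
  qed
qed

text \<open>An element \<open>r\<close> fixes the translate of \<open>f\<close> by \<open>k\<close>
  iff \<open>inv k \<otimes> r \<otimes> k\<close> fixes \<open>f\<close>. So it suffices that
  \<open>k\<close> conjugates each nontrivial element of the finite stabilizer of \<open>f\<close>
  off \<open>R\<close>, and moves \<open>f\<close> off \<open>S\<close>. The former orbits are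
  infinite by icc, the latter because edge stabilizers are finite.\<close>

lemma generic_edge:
  assumes f: "f \<in> arcs T" "finite (stabilizer G \<psi> f)"
    and icc: "icc (G\<lparr>carrier := stabilizer G \<phi> (tail T f)\<rparr>)"
    and R: "finite R" and S: "finite S"
  shows "\<exists>k \<in> stabilizer G \<phi> (tail T f). \<psi> k f \<notin> S \<and>
    (\<forall>r \<in> R. r \<in> carrier G \<longrightarrow> r \<noteq> \<one> \<longrightarrow> \<psi> r (\<psi> k f) \<noteq> \<psi> k f)"
proof -
  let ?v = "tail T f"
  let ?K = "stabilizer G \<phi> ?v"
  let ?GK = "G\<lparr>carrier := ?K\<rparr>"
  have v: "?v \<in> verts T" using f by simp
  have K: "subgroup ?K G" by (rule stabilizer_subgroup[OF v])
  have Kc: "k \<in> ?K \<Longrightarrow> k \<in> carrier G" for k by (simp add: stabilizer_def)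
  interpret K: group ?GK by (rule subgroup.subgroup_is_group[OF K is_group])
  have inf: "infinite ?K" using icc by (simp add: icc_def)
  \<comment> \<open>The sum type joins conjugation and the action on edges, so that one application
    of Neumann's lemma meets both requirements with the same \<open>k\<close>.\<close>
  define act :: "'g \<Rightarrow> 'g + 'e \<Rightarrow> 'g + 'e" where
    "act k y = (case y of Inl x \<Rightarrow> Inl (k \<otimes> x \<otimes> inv k) | Inr e \<Rightarrow> Inr (\<psi> k e))" for k y
  define I where "I = Inl ` (stabilizer G \<psi> f - {\<one>}) \<union> {Inr f}"
  have fK: "stabilizer G \<psi> f \<subseteq> ?K" by (rule edge_stabilizer_subset[OF f(1)])
  have "\<exists>k \<in> carrier ?GK. \<forall>y \<in> I. act k y \<notin> Inl ` R \<union> Inr ` S"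
  proof (rule K.act_avoids_finite_sets)
    show "finite I" using f by (simp add: I_def)
    show "finite (Inl ` R \<union> Inr ` S)" using R S by simp
    show "act (k \<otimes>\<^bsub>?GK\<^esub> l) y = act k (act l y)"
      if "k \<in> carrier ?GK" "l \<in> carrier ?GK" "y \<in> I" for k l y
    proof -
      have c: "k \<in> carrier G" "l \<in> carrier G" using that Kc by auto
      from that(3) consider x where "y = Inl x" "x \<in> carrier G" | "y = Inr f"
        using fK Kc by (auto simp: I_def)
      then show ?thesis
        using c f(1) by cases (simp_all add: act_def inv_mult_group m_assoc edge.composition_rule)
    qed
    show "infinite ((\<lambda>k. act k y) ` carrier ?GK)" if "y \<in> I" for y
    proof (cases y)
      case (Inl x)
      then have x: "x \<in> ?K" "x \<noteq> \<one>" using that fK by (auto simp: I_def)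
      have "{h \<otimes>\<^bsub>?GK\<^esub> x \<otimes>\<^bsub>?GK\<^esub> inv\<^bsub>?GK\<^esub> h | h. h \<in> carrier ?GK} =
          (\<lambda>h. h \<otimes>\<^bsub>?GK\<^esub> x \<otimes>\<^bsub>?GK\<^esub> inv\<^bsub>?GK\<^esub> h) ` carrier ?GK"
        by blast
      also have "Inl ` \<dots> = (\<lambda>k. act k y) ` carrier ?GK"
        unfolding image_image using Inl by (intro image_cong) (simp_all add: act_def m_inv_consistent[OF K])
      finally have "(\<lambda>k. act k y) ` carrier ?GK = Inl ` {h \<otimes>\<^bsub>?GK\<^esub> x \<otimes>\<^bsub>?GK\<^esub> inv\<^bsub>?GK\<^esub> h | h. h \<in> carrier ?GK}"
        by simp
      moreover have "infinite {h \<otimes>\<^bsub>?GK\<^esub> x \<otimes>\<^bsub>?GK\<^esub> inv\<^bsub>?GK\<^esub> h | h. h \<in> carrier ?GK}"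
        using icc x by (simp add: icc_def)
      ultimately show ?thesis
        by (simp only: finite_image_iff[OF inj_on_subset[OF inj_Inl subset_UNIV]] not_False_eq_True)
    next
      case (Inr e)
      then have "(\<lambda>k. act k y) ` carrier ?GK = Inr ` (\<lambda>k. \<psi> k f) ` ?K"
        using that by (auto simp: act_def I_def)
      then show ?thesis
        using infinite_edge_orbit[OF v inf f]
        by (simp only: finite_image_iff[OF inj_on_subset[OF inj_Inr subset_UNIV]] not_False_eq_True)
    qed
  qed
  then obtain k where k: "k \<in> ?K" "\<And>y. y \<in> I \<Longrightarrow> act k y \<notin> Inl ` R \<union> Inr ` S" by auto
  have kc: "k \<in> carrier G" by (rule Kc[OF k(1)])
  have "\<psi> k f \<notin> S" using k(2)[of "Inr f"] by (auto simp: I_def act_def)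
  moreover have "\<psi> r (\<psi> k f) \<noteq> \<psi> k f" if r: "r \<in> R" "r \<in> carrier G" "r \<noteq> \<one>" for r
  proof
    assume fixed: "\<psi> r (\<psi> k f) = \<psi> k f"
    define x where "x = inv k \<otimes> r \<otimes> k"
    have "\<psi> x f = f"
      using fixed kc r(2) f(1) edge_act_inv_eq_iff[of k "\<psi> k f" f]
      by (simp add: x_def m_assoc edge.composition_rule edge_act_closed)
    moreover have kx: "k \<otimes> x \<otimes> inv k = r"
      using kc r(2) by (simp add: x_def m_assoc mult_inv_cancel_left)
    then have "x \<noteq> \<one>" using kc r(3) by auto
    ultimately have "Inl x \<in> I" using kc r(2) by (simp add: I_def stabilizer_def x_def)
    then show False using k(2)[of "Inl x"] kx r(1) by (auto simp: act_def)
  qed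
  ultimately show ?thesis using k(1) by blast
qed

text \<open>An element that fixes \<open>head T f\<close> but not \<open>f\<close> turns the tree
  about that vertex: the path from \<open>tail T f\<close> through \<open>head T f\<close> to the
  image of \<open>tail T f\<close> does not backtrack. The inverse has the same property.\<close>

lemma stabilizer_moves_neighbour:
  assumes f: "f \<in> arcs T" "finite (stabilizer G \<psi> f)" and inf: "infinite (stabilizer G \<phi> (head T f))"
  obtains k where "k \<in> carrier G" "\<phi> k (tail T f) \<in> half_tree f" "\<phi> (inv k) (tail T f) \<in> half_tree f"
proof -
  have "\<not> stabilizer G \<phi> (head T f) \<subseteq> stabilizer G \<psi> f"
    using f(2) inf finite_subset by blast
  then obtain k where k: "k \<in> carrier G" "\<phi> k (head T f) = head T f" "\<psi> k f \<noteq> f"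
    by (auto simp: stabilizer_def)
  have *: "\<phi> l (tail T f) \<in> half_tree f"
    if l: "l \<in> carrier G" "\<phi> l (head T f) = head T f" "\<psi> l f \<noteq> f" for l
  proof -
    have "geo (tail T f) (\<phi> l (tail T f)) = [f, bar (\<psi> l f)]"
    proof (rule geo_eqI)
      show "awalk (tail T f) [f, bar (\<psi> l f)] (\<phi> l (tail T f))"
        using l f by (simp add: awalk_simps edge_act_closed tail_act head_act vertex_act_closed)
      show "reduced [f, bar (\<psi> l f)]" using l(3) by (simp add: arev_eq_iff)
    qed
    then show ?thesis using l f by (simp add: half_tree_def vertex_act_closed)
  qed
  have "\<phi> (inv k) (head T f) = head T f" "\<psi> (inv k) f \<noteq> f"
    using k f vertex_act_inv_eq_iff[of k "head T f" "head T f"] edge_act_inv_eq_iff[of k f f] by auto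
  then show ?thesis using that[OF k(1)] * k by simp
qed

end

section \<open>Enlarging a free subgroup\<close>

context serre_tree_action
begin

lemma finite_transporter:
  assumes "subgroup H G" "free_on_vertices H" "x \<in> verts T"
  shows "finite {h \<in> H. \<phi> h x = y}"
proof (cases "\<exists>k \<in> H. \<phi> k x = y")
  case True
  then obtain k where "k \<in> H" "\<phi> k x = y" by blast
  then have "{h \<in> H. \<phi> h x = y} \<subseteq> {k}"
    using free_on_vertices_inj[OF assms(1,2) _ _ assms(3)] by auto
  then show ?thesis using finite_subset by blast
next
  case False
  then have "{h \<in> H. \<phi> h x = y} = {}" by blast
  then show ?thesis by (metis finite.emptyI)
qed

lemma in_half_tree_translate_iff:
  assumes "p \<in> carrier G" "e \<in> arcs T" "x \<in> verts T"
  shows "x \<in> half_tree (\<psi> (inv p) e) \<longleftrightarrow> \<phi> p x \<in> half_tree e"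
  using half_tree_act[of p "\<psi> (inv p) e" x] edge_act_inv_eq_iff[of p e "\<psi> (inv p) e"] assms
  by (simp add: edge_act_closed)

text \<open>The inductive step. Adjoining \<open>inv (b i) \<otimes> g \<otimes> a i\<close> makes
  \<open>g\<close> map the coset of \<open>a i\<close> to that of \<open>b i\<close>; a single
  \<open>g\<close> has to serve all indices.\<close>

lemma extend_free_subgroup:
  fixes a b :: "nat \<Rightarrow> 'g"
  assumes f: "f \<in> arcs T"
    and edges: "\<And>e. e \<in> arcs T \<Longrightarrow> finite (stabilizer G \<psi> e)"
    and icc: "\<And>v. v \<in> verts T \<Longrightarrow> icc (G\<lparr>carrier := stabilizer G \<phi> v\<rparr>)"
    and S: "finite S" "S \<subseteq> carrier G" and free: "free_on_vertices (generate G S)"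
    and F: "finite F" "F \<subseteq> carrier G" "F \<inter> generate G S = {}"
    and ab: "\<And>i. i < n \<Longrightarrow> a i \<in> carrier G" "\<And>i. i < n \<Longrightarrow> b i \<in> carrier G"
    and sep: "\<And>i j. i < n \<Longrightarrow> j < n \<Longrightarrow> i \<noteq> j \<Longrightarrow> inv (a i) \<otimes> a j \<notin> generate G S"
      "\<And>i j. i < n \<Longrightarrow> j < n \<Longrightarrow> i \<noteq> j \<Longrightarrow> inv (b i) \<otimes> b j \<notin> generate G S"
  obtains g where "g \<in> carrier G"
    "free_on_vertices (generate G (S \<union> (\<lambda>i. inv (b i) \<otimes> g \<otimes> a i) ` {..<n}))"
    "F \<inter> generate G (S \<union> (\<lambda>i. inv (b i) \<otimes> g \<otimes> a i) ` {..<n}) = {}"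
proof -
  define H where "H = generate G S"
  define v where "v = tail T f"
  \<comment> \<open>The index \<open>(True, i)\<close> stands for
    \<open>inv (b i) \<otimes> g \<otimes> a i\<close> and \<open>(False, i)\<close> for its
    inverse. The representative \<open>p j\<close> is the one whose inverse translates a generic
    edge at \<open>v\<close> to the edge of the half-tree of \<open>j\<close>.\<close>
  define J where "J = (UNIV :: bool set) \<times> {..<n}"
  define \<tau> :: "bool \<times> nat \<Rightarrow> bool \<times> nat" where "\<tau> j = (\<not> fst j, snd j)" for j
  define p where "p j = (if fst j then b (snd j) else a (snd j))" for j :: "bool \<times> nat"
  have H: "subgroup H G" unfolding H_def by (rule generate_is_subgroup[OF S(2)])
  note Hc = subgroup.mem_carrier[OF H]
  have fH: "free_on_vertices H" using free by (simp add: H_def)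
  have v: "v \<in> verts T" using f by (simp add: v_def)
  have J: "finite J" by (simp add: J_def)
  have p: "p j \<in> carrier G" if "j \<in> J" for j using that ab by (auto simp: J_def p_def)
  have \<tau>J: "\<tau> j \<in> J" if "j \<in> J" for j using that by (auto simp: J_def \<tau>_def)

  \<comment> \<open>\<open>D\<close> holds the directions at \<open>v\<close> which the two generic edges have to avoid, and \<open>R\<close> the elements
    which must neither fix one of them nor carry one to the other.\<close>
  define R where "R = {x. \<exists>l \<in> J. \<exists>m \<in> J. \<exists>h \<in> H. x = p m \<otimes> h \<otimes> inv (p l) \<and> \<phi> x v = v}"
  \<comment> \<open>For given \<open>l\<close> and \<open>m\<close>, the condition prescribes where
    \<open>h\<close> sends one vertex, and freeness leaves at most one such
    \<open>h\<close>.\<close>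
  have R: "finite R"
  proof -
    have "R \<subseteq> (\<Union>l \<in> J. \<Union>m \<in> J. (\<lambda>h. p m \<otimes> h \<otimes> inv (p l)) `
        {h \<in> H. \<phi> h (\<phi> (inv (p l)) v) = \<phi> (inv (p m)) v})"
    proof
      fix x assume "x \<in> R"
      then obtain l m h where x: "l \<in> J" "m \<in> J" "h \<in> H" "x = p m \<otimes> h \<otimes> inv (p l)" "\<phi> x v = v"
        by (auto simp: R_def)
      have "\<phi> (p m) (\<phi> h (\<phi> (inv (p l)) v)) = v"
        using x p v Hc by (simp add: vertex.composition_rule vertex_act_closed)
      then have "\<phi> h (\<phi> (inv (p l)) v) = \<phi> (inv (p m)) v"
        using vertex_act_inv_eq_iff[of "p m" v "\<phi> h (\<phi> (inv (p l)) v)"] x p v Hc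
        by (simp add: vertex_act_closed)
      then show "x \<in> (\<Union>l \<in> J. \<Union>m \<in> J. (\<lambda>h. p m \<otimes> h \<otimes> inv (p l)) `
        {h \<in> H. \<phi> h (\<phi> (inv (p l)) v) = \<phi> (inv (p m)) v})"
        using x(1-4) by blast
    qed
    moreover have "finite {h \<in> H. \<phi> h (\<phi> (inv (p l)) v) = \<phi> (inv (p m)) v}" if "l \<in> J" for l m
      using finite_transporter[OF H fH] p[OF that] v by (simp add: vertex_act_closed)
    ultimately show ?thesis using J finite_subset by (meson finite_UN_I finite_imageI)
  qed

  \<comment> \<open>These vertices must have \<open>H\<close>-orbits outside all half-trees: the
    base points of the half-trees, for disjointness and for freeness, and \<open>v\<close> with its
    images under \<open>F\<close>, for excluding \<open>F\<close>.\<close>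
  define W where "W = (\<lambda>l. \<phi> (inv (p l)) v) ` J \<union> {v} \<union> (\<lambda>x. \<phi> x v) ` F"
  have W: "finite W" "W \<subseteq> verts T"
    using J F p v by (auto simp: W_def vertex_act_closed subset_iff)
  define D where "D = (\<Union>l \<in> J. \<Union>w \<in> W. \<psi> (p l) ` directions H (\<phi> (inv (p l)) v) w)"
  have D: "finite D"
    unfolding D_def using J W p v
    by (intro finite_UN_I finite_imageI)
      (auto simp: H_def vertex_act_closed subset_iff intro!: finite_directions[OF S free])

  note generic = generic_edge[OF f edges[OF f] icc[OF tail_in_verts[OF f]], folded v_def]
  obtain c where c: "c \<in> stabilizer G \<phi> v" "\<psi> c f \<notin> D"
    "\<And>r. r \<in> R \<Longrightarrow> r \<in> carrier G \<Longrightarrow> r \<noteq> \<one> \<Longrightarrow> \<psi> r (\<psi> c f) \<noteq> \<psi> c f"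
    using generic[OF R D] by blast
  \<comment> \<open>The second edge also avoids the images of the first under \<open>R\<close>, and
    under the inverses so that no element of \<open>R\<close> carries the second edge to the
    first.\<close>
  define D' where "D' = D \<union> {\<psi> c f} \<union> (\<lambda>r. \<psi> r (\<psi> c f)) ` R \<union> (\<lambda>r. \<psi> (inv r) (\<psi> c f)) ` R"
  have "finite D'" using D R by (simp add: D'_def)
  then obtain d where d: "d \<in> stabilizer G \<phi> v" "\<psi> d f \<notin> D'"
    "\<And>r. r \<in> R \<Longrightarrow> r \<in> carrier G \<Longrightarrow> r \<noteq> \<one> \<Longrightarrow> \<psi> r (\<psi> d f) \<noteq> \<psi> d f"
    using generic[OF R] by blast
  have "infinite (stabilizer G \<phi> (head T f))" using icc[of "head T f"] f by (simp add: icc_def)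
  then obtain k where k: "k \<in> carrier G" "\<phi> k v \<in> half_tree f" "\<phi> (inv k) v \<in> half_tree f"
    using stabilizer_moves_neighbour[OF f edges[OF f]] unfolding v_def by blast
  \<comment> \<open>Since \<open>c\<close> and \<open>d\<close> fix \<open>v\<close>, the images of
    \<open>v\<close> under \<open>g\<close> and \<open>inv g\<close> are those under
    \<open>k\<close> and \<open>inv k\<close>, moved by \<open>c\<close> and \<open>d\<close>
    respectively. They lie beyond the translates of \<open>f\<close> by \<open>c\<close> and by
    \<open>d\<close>.\<close>
  define g where "g = c \<otimes> k \<otimes> inv d"
  define gg where "gg \<epsilon> = (if \<epsilon> then g else inv g)" for \<epsilon>
  define ee where "ee \<epsilon> = (if \<epsilon> then \<psi> c f else \<psi> d f)" for \<epsilon>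
  have cd: "c \<in> carrier G" "d \<in> carrier G" "\<phi> c v = v" "\<phi> d v = v"
    using c d by (simp_all add: stabilizer_def)
  have g: "g \<in> carrier G" using cd k by (simp add: g_def)
  have gg: "gg \<epsilon> \<in> carrier G" "inv (gg \<epsilon>) = gg (\<not> \<epsilon>)" for \<epsilon> using g by (auto simp: gg_def)
  have ee: "ee \<epsilon> \<in> arcs T" "tail T (ee \<epsilon>) = v" for \<epsilon>
    using cd f by (auto simp: ee_def edge_act_closed tail_act v_def)
  have gg_v: "\<phi> (gg \<epsilon>) v \<in> half_tree (ee \<epsilon>)" for \<epsilon>
  proof -
    have cd_inv: "\<phi> (inv c) v = v" "\<phi> (inv d) v = v"
      using cd v vertex_act_inv_eq_iff by simp_all
    have "\<phi> g v = \<phi> c (\<phi> k v)"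
      using cd cd_inv k v by (simp add: g_def vertex.composition_rule vertex_act_closed)
    moreover have "inv g = d \<otimes> inv k \<otimes> inv c"
      using cd k by (simp add: g_def inv_mult_group m_assoc)
    then have "\<phi> (inv g) v = \<phi> d (\<phi> (inv k) v)"
      using cd cd_inv k v by (simp add: vertex.composition_rule vertex_act_closed)
    ultimately show ?thesis
      using half_tree_act[of c f "\<phi> k v"] half_tree_act[of d f "\<phi> (inv k) v"] cd f k v
      by (simp add: gg_def ee_def vertex_act_closed)
  qed

  define t where "t j = inv (p j) \<otimes> gg (fst j) \<otimes> p (\<tau> j)" for j
  define E where "E j = \<psi> (inv (p j)) (ee (fst j))" for j
  have E: "E j \<in> arcs T" "tail T (E j) = \<phi> (inv (p j)) v" "tail T (E j) \<in> W" if "j \<in> J" for j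
    using that p ee by (simp_all add: E_def edge_act_closed tail_act W_def)

  have avoid: "\<phi> h w \<notin> half_tree (E l)" if "h \<in> H" "l \<in> J" "w \<in> W" for h l w
  proof
    assume "\<phi> h w \<in> half_tree (E l)"
    then have "E l \<in> directions H (\<phi> (inv (p l)) v) w"
      using that E by (auto simp: directions_def)
    then have "\<psi> (p l) (E l) \<in> D" unfolding D_def using that by blast
    moreover have "\<psi> (p l) (E l) = ee (fst l)"
      using edge_act_inv_eq_iff[of "p l" "ee (fst l)" "E l"] E[OF that(2)] ee p[OF that(2)]
      by (simp add: E_def)
    ultimately show False using c(2) d(2) by (auto simp: ee_def D'_def split: if_splits)
  qed

  have translates_differ: "\<psi> h (E l) \<noteq> E m"
    if h: "h \<in> H" and l: "l \<in> J" and m: "m \<in> J" and neq: "h \<noteq> \<one> \<or> l \<noteq> m" for h l m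
  proof
    assume eq: "\<psi> h (E l) = E m"
    define x where "x = p m \<otimes> h \<otimes> inv (p l)"
    have x: "x \<in> carrier G" using p l m Hc[OF h] by (simp add: x_def)
    have "\<psi> x (ee (fst l)) = \<psi> (p m) (\<psi> h (E l))"
      using p[OF l] p[OF m] Hc[OF h] ee by (simp add: x_def E_def edge.composition_rule edge_act_closed)
    also have "\<dots> = ee (fst m)"
      using edge_act_inv_eq_iff[of "p m" "ee (fst m)" "E m"] E[OF m] ee p[OF m] eq
      by (simp add: E_def)
    finally have xe: "\<psi> x (ee (fst l)) = ee (fst m)" .
    then have "\<phi> x v = v" using tail_act[OF x, of "ee (fst l)"] ee by simp
    then have xR: "x \<in> R" using h l m x_def by (auto simp: R_def)
    have cd_neq: "\<psi> c f \<noteq> \<psi> d f" using d(2) by (auto simp: D'_def)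
    show False
    \<comment> \<open>If \<open>x\<close> is trivial, \<open>h\<close> is a quotient of two of the
      \<open>a i\<close> or of two of the \<open>b i\<close>, and the distinctness of the cosets
      applies. If not, genericity of the two edges excludes \<open>x\<close>.\<close>
    proof (cases "x = \<one>")
      case True
      then have "ee (fst l) = ee (fst m)" using xe ee by (simp add: edge_act_one)
      then have fst: "fst l = fst m" using cd_neq by (auto simp: ee_def split: if_splits)
      have "h = inv (p m) \<otimes> (x \<otimes> p l)"
        using p[OF l] p[OF m] Hc[OF h] by (simp add: x_def m_assoc mult_inv_cancel_left)
      then have hp: "h = inv (p m) \<otimes> p l" using True p[OF l] by simp
      have "snd l < n" "snd m < n" using l m by (auto simp: J_def)
      then have "snd m = snd l"
        using sep[of "snd m" "snd l"] h hp fst by (auto simp: p_def H_def split: if_splits)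
      then have "l = m" using fst by (simp add: prod_eq_iff)
      then show False using neq hp p[OF m] by simp
    next
      case False
      have "\<psi> x (\<psi> c f) \<noteq> \<psi> c f" "\<psi> x (\<psi> d f) \<noteq> \<psi> d f" using c(3) d(3) xR x False by blast+
      moreover have "\<psi> x (\<psi> c f) \<noteq> \<psi> d f" using d(2) xR unfolding D'_def by (metis UnI1 UnI2 imageI)
      moreover have "\<psi> x (\<psi> d f) \<noteq> \<psi> c f"
      proof
        assume "\<psi> x (\<psi> d f) = \<psi> c f"
        then have "\<psi> (inv x) (\<psi> c f) = \<psi> d f"
          using edge_act_inv_eq_iff[of x "\<psi> c f" "\<psi> d f"] x cd f by (simp add: edge_act_closed)
        then show False using d(2) xR unfolding D'_def by (metis UnI2 imageI)
      qed
      ultimately show False using xe by (auto simp: ee_def split: if_splits)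
    qed
  qed

  interpret ping_pong G "verts T" \<phi> H J \<tau> t "\<lambda>j. half_tree (E j)"
  proof (intro ping_pong.intro ping_pong_axioms.intro is_group vertex.group_action_axioms)
    show "subgroup H G" by (rule H)
  next
    fix j assume j: "j \<in> J"
    show "\<tau> j \<in> J" by (rule \<tau>J[OF j])
    show "\<tau> (\<tau> j) = j" "\<tau> j \<noteq> j" by (auto simp: \<tau>_def prod_eq_iff)
    show "t j \<in> carrier G" using p[OF j] p[OF \<tau>J[OF j]] gg by (simp add: t_def)
    have "\<tau> (\<tau> j) = j" "fst (\<tau> j) = (\<not> fst j)" by (simp_all add: \<tau>_def)
    then show "t (\<tau> j) = inv (t j)"
      using p[OF j] p[OF \<tau>J[OF j]] gg by (simp add: t_def inv_mult_group m_assoc)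
    show "half_tree (E j) \<subseteq> verts T" by (rule half_tree_verts)
    fix x assume x: "x \<in> verts T" "x \<notin> half_tree (E (\<tau> j))"
    define y where "y = \<phi> (p (\<tau> j)) x"
    have y: "y \<in> verts T" using x p[OF \<tau>J[OF j]] by (simp add: y_def vertex_act_closed)
    have "y \<notin> half_tree (ee (\<not> fst j))"
      using in_half_tree_translate_iff[OF p[OF \<tau>J[OF j]], of "ee (\<not> fst j)" x] x ee
      by (simp add: E_def y_def \<tau>_def)
    then have "\<phi> (gg (fst j)) y \<in> half_tree (ee (fst j))"
      using half_tree_play[of "gg (fst j)" "ee (fst j)" "ee (\<not> fst j)" y] gg ee gg_v y
      by metis
    moreover have "\<phi> (p j) (\<phi> (t j) x) = \<phi> (gg (fst j)) y"
    proof -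
      have "p j \<otimes> t j = gg (fst j) \<otimes> p (\<tau> j)"
        using p[OF j] p[OF \<tau>J[OF j]] gg by (simp add: t_def m_assoc mult_inv_cancel_left)
      moreover have "t j \<in> carrier G" using p[OF j] p[OF \<tau>J[OF j]] gg by (simp add: t_def)
      ultimately show ?thesis
        using x p[OF j] p[OF \<tau>J[OF j]] gg vertex.composition_rule[of x "p j" "t j"]
          vertex.composition_rule[of x "gg (fst j)" "p (\<tau> j)"] by (simp add: y_def)
    qed
    moreover have "\<phi> (t j) x \<in> verts T"
      using x p[OF j] p[OF \<tau>J[OF j]] gg by (simp add: t_def vertex_act_closed)
    ultimately show "\<phi> (t j) x \<in> half_tree (E j)"
      using in_half_tree_translate_iff[OF p[OF j], of "ee (fst j)" "\<phi> (t j) x"] ee by (simp add: E_def)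
  next
    fix h l m assume hlm: "h \<in> H" "l \<in> J" "m \<in> J" "h \<noteq> \<one> \<or> l \<noteq> m"
    have h: "h \<in> carrier G" "inv h \<in> H" using Hc hlm subgroup.m_inv_closed[OF H] by auto
    have El: "E l \<in> arcs T" "\<psi> h (E l) \<in> arcs T" and Em: "E m \<in> arcs T"
      using E hlm h by (simp_all add: edge_act_closed)
    have "half_tree (\<psi> h (E l)) \<inter> half_tree (E m) = {}"
    proof (rule half_trees_disjoint[OF El(2) Em translates_differ[OF hlm]])
      show "tail T (\<psi> h (E l)) \<notin> half_tree (E m)"
        using avoid[OF hlm(1,3) E(3)[OF hlm(2)]] h El by (simp add: tail_act)
      show "tail T (E m) \<notin> half_tree (\<psi> h (E l))"
        using avoid[OF h(2) hlm(2) E(3)[OF hlm(3)]] Em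
          in_half_tree_translate_iff[of "inv h" "E l" "tail T (E m)"] h El by simp
    qed
    then show "\<phi> h ` half_tree (E l) \<inter> half_tree (E m) = {}"
      using half_tree_image h El by simp
  qed

  define K where "K = S \<union> (\<lambda>i. inv (b i) \<otimes> g \<otimes> a i) ` {..<n}"
  have K: "K \<subseteq> H \<union> t ` J"
  proof -
    have "inv (b i) \<otimes> g \<otimes> a i = t (True, i)" for i by (simp add: t_def \<tau>_def p_def gg_def)
    then show ?thesis unfolding K_def H_def J_def by (auto intro: generate.incl)
  qed
  have outside: "w \<in> outside" if "w \<in> W" for w
    using that W avoid by (auto simp: outside_def)
  have Kc: "K \<subseteq> carrier G" using S g ab by (auto simp: K_def)

  have "F \<inter> generate G K = {}"
  proof (rule ccontr)
    assume "F \<inter> generate G K \<noteq> {}"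
    then obtain x where x: "x \<in> F" "x \<in> generate G K" by blast
    then have "x \<notin> H" using F(3) by (auto simp: H_def)
    \<comment> \<open>Both \<open>v\<close> and its image under \<open>x\<close> belong to
      \<open>W\<close>, which is impossible for a generated element outside
      \<open>H\<close>.\<close>
    moreover have "v \<in> outside" by (rule outside) (simp add: W_def)
    ultimately obtain h j where "h \<in> H" "j \<in> J" "\<phi> h (\<phi> x v) \<in> half_tree (E j)"
      using generate_play[OF K x(2)] by blast
    then show False using avoid x(1) by (simp add: W_def)
  qed
  moreover have "free_on_vertices (generate G K)"
    unfolding free_on_vertices_def
  proof (intro ballI impI)
    fix w u assume w: "w \<in> generate G K" and u: "u \<in> verts T" "\<phi> w u = u"
    have wc: "w \<in> carrier G" using generate_in_carrier[OF Kc w] .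
    have conj_fixes: "\<phi> (q \<otimes> w \<otimes> inv q) (\<phi> q u) = \<phi> q u" if "q \<in> carrier G" for q
    proof -
      have "q \<otimes> w \<otimes> inv q \<otimes> q = q \<otimes> w" using that wc by (simp add: m_assoc)
      then show ?thesis
        using that wc u vertex.composition_rule[of u "q \<otimes> w \<otimes> inv q" q]
          vertex.composition_rule[of u q w] by simp
    qed
    show "w = \<one>"
      using K w
    proof (cases rule: conj_into_H_or_play)
      case (conj q)
      then have "q \<otimes> w \<otimes> inv q = \<one>"
        using free_on_verticesD[OF fH _ _ conj_fixes] u by (simp add: vertex_act_closed)
      then have "q \<otimes> w = q" using conj(1) wc inv_solve_right'[of \<one> "q \<otimes> w" q] by simp
      then show ?thesis using conj(1) wc by (simp add: r_cancel_one)
    next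
      case (play q j)
      \<comment> \<open>Preserving the half-tree would not exclude a fixed vertex. The tail lies
        just outside the half-tree and is sent into it, because it belongs to
        \<open>outside\<close>.\<close>
      have "\<phi> (q \<otimes> w \<otimes> inv q) (tail T (E j)) \<in> half_tree (E j)"
        using play outside[OF E(3)[OF play(2)]] by blast
      then have "\<phi> (q \<otimes> w \<otimes> inv q) (\<phi> q u) \<noteq> \<phi> q u"
        using no_fixed_vertex[of "q \<otimes> w \<otimes> inv q" "E j" "\<phi> q u"] play wc u E
        by (simp add: vertex_act_closed)
      then show ?thesis using conj_fixes[OF play(1)] by contradiction
    qed
  qed
  ultimately show ?thesis using that[OF g] by (simp add: K_def)
qed

end

section \<open>The limit subgroup and its coset action\<close>

context serre_tree_action
begin

text \<open>Visiting each request once is enough. Tuples separated modulo the union are separated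
  modulo every stage, hence when their turn comes; elements put into the subgroup stay there, and
  elements put into \<open>F\<close> stay excluded from all later stages.\<close>

lemma exists_highly_transitive_core_free_subgroup:
  assumes count: "countable (carrier G)" and f: "f \<in> arcs T"
    and edges: "\<And>e. e \<in> arcs T \<Longrightarrow> finite (stabilizer G \<psi> e)"
    and icc: "\<And>v. v \<in> verts T \<Longrightarrow> icc (G\<lparr>carrier := stabilizer G \<phi> v\<rparr>)"
  obtains H where "subgroup H G"
    and "\<And>\<gamma>. \<gamma> \<in> carrier G \<Longrightarrow> \<gamma> \<noteq> \<one> \<Longrightarrow> \<exists>c \<in> carrier G. c \<otimes> \<gamma> \<otimes> inv c \<notin> H"
    and "\<And>as bs. \<lbrakk> length as = length bs; set as \<subseteq> carrier G; set bs \<subseteq> carrier G;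
      \<And>i j. i < length as \<Longrightarrow> j < length as \<Longrightarrow> i \<noteq> j \<Longrightarrow> inv (as ! i) \<otimes> as ! j \<notin> H;
      \<And>i j. i < length as \<Longrightarrow> j < length as \<Longrightarrow> i \<noteq> j \<Longrightarrow> inv (bs ! i) \<otimes> bs ! j \<notin> H \<rbrakk> \<Longrightarrow>
      \<exists>g \<in> carrier G. \<forall>i < length as. inv (bs ! i) \<otimes> g \<otimes> as ! i \<in> H"
proof -
  \<comment> \<open>A request joins two tasks. Empty tuples make the transitivity task vacuous, and
    \<open>\<gamma> = \<one>\<close> switches off the conjugation task.\<close>
  define items where "items = {(as, bs, \<gamma>). as \<in> lists (carrier G) \<and> bs \<in> lists (carrier G) \<and>
    length as = length bs \<and> \<gamma> \<in> carrier G}"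
  have "countable (lists (carrier G) \<times> lists (carrier G) \<times> carrier G)" using count by simp
  moreover have "items \<subseteq> lists (carrier G) \<times> lists (carrier G) \<times> carrier G" by (auto simp: items_def)
  ultimately have items: "countable items" using countable_subset by blast
  have "([], [], \<one>) \<in> items" by (simp add: items_def)
  then have items_ne: "items \<noteq> {}" by blast
  define separated where "separated H as \<longleftrightarrow>
    (\<forall>i < length as. \<forall>j < length as. i \<noteq> j \<longrightarrow> inv (as ! i) \<otimes> as ! j \<notin> H)" for H and as :: "'g list"
  define good where "good = (\<lambda>(S, F). finite S \<and> S \<subseteq> carrier G \<and> free_on_vertices (generate G S) \<and>
    finite F \<and> F \<subseteq> carrier G \<and> F \<inter> generate G S = {})"
  define treats where "treats = (\<lambda>(as, bs, \<gamma>) (S, F) (S', F'). S \<subseteq> S' \<and> F \<subseteq> F' \<and>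
    (\<gamma> \<noteq> \<one> \<longrightarrow> (\<exists>c \<in> carrier G. c \<otimes> \<gamma> \<otimes> inv c \<in> F')) \<and>
    (separated (generate G S) as \<longrightarrow> separated (generate G S) bs \<longrightarrow>
      (\<exists>g \<in> carrier G. \<forall>i < length as. inv (bs ! i) \<otimes> g \<otimes> as ! i \<in> generate G S')))"
  let ?v = "tail T f"
  have v: "?v \<in> verts T" "infinite (stabilizer G \<phi> ?v)" using f icc[of ?v] by (auto simp: icc_def)

  have step: "\<exists>y. good y \<and> treats x s y" if s: "good s" and x: "x \<in> items" for s x
  proof -
    obtain S F where s_eq: "s = (S, F)" by (cases s)
    obtain as bs \<gamma> where x_eq: "x = (as, bs, \<gamma>)" by (cases x)
    have S: "finite S" "S \<subseteq> carrier G" "free_on_vertices (generate G S)"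
      and F: "finite F" "F \<subseteq> carrier G" "F \<inter> generate G S = {}" using s s_eq by (auto simp: good_def)
    have ab: "set as \<subseteq> carrier G" "set bs \<subseteq> carrier G" "length as = length bs" and \<gamma>: "\<gamma> \<in> carrier G"
      using x x_eq by (auto simp: items_def)
    have "\<exists>S'. S \<subseteq> S' \<and> good (S', F) \<and> (separated (generate G S) as \<longrightarrow> separated (generate G S) bs \<longrightarrow>
      (\<exists>g \<in> carrier G. \<forall>i < length as. inv (bs ! i) \<otimes> g \<otimes> as ! i \<in> generate G S'))"
    proof (cases "separated (generate G S) as \<and> separated (generate G S) bs")
      case True
      obtain g where g: "g \<in> carrier G"
        "free_on_vertices (generate G (S \<union> (\<lambda>i. inv (bs ! i) \<otimes> g \<otimes> as ! i) ` {..<length as}))"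
        "F \<inter> generate G (S \<union> (\<lambda>i. inv (bs ! i) \<otimes> g \<otimes> as ! i) ` {..<length as}) = {}"
      proof (rule extend_free_subgroup[OF f edges icc S F, where n = "length as" and a = "(!) as" and b = "(!) bs"])
        show "as ! i \<in> carrier G" "bs ! i \<in> carrier G" if "i < length as" for i
          using that ab by (auto simp: subset_iff)
        show "inv (as ! i) \<otimes> as ! j \<notin> generate G S" "inv (bs ! i) \<otimes> bs ! j \<notin> generate G S"
          if "i < length as" "j < length as" "i \<noteq> j" for i j
          using that True ab(3) by (simp_all add: separated_def)
      qed
      let ?S' = "S \<union> (\<lambda>i. inv (bs ! i) \<otimes> g \<otimes> as ! i) ` {..<length as}"
      have "?S' \<subseteq> carrier G" using S(2) g(1) ab by (auto simp: subset_iff)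
      then have "good (?S', F)" using S(1) F g by (simp add: good_def)
      moreover have "\<forall>i < length as. inv (bs ! i) \<otimes> g \<otimes> as ! i \<in> generate G ?S'"
        by (auto intro: generate.incl)
      ultimately show ?thesis using g(1) by blast
    next
      case False
      then show ?thesis using s s_eq by blast
    qed
    then obtain S' where S': "S \<subseteq> S'" "good (S', F)"
      "separated (generate G S) as \<longrightarrow> separated (generate G S) bs \<longrightarrow>
        (\<exists>g \<in> carrier G. \<forall>i < length as. inv (bs ! i) \<otimes> g \<otimes> as ! i \<in> generate G S')"
      by blast
    show ?thesis
    proof (cases "\<gamma> = \<one>")
      case True
      then show ?thesis
        using S' s_eq x_eq by (intro exI[of _ "(S', F)"]) (auto simp: treats_def)
    next
      case False
      have "finite S'" "S' \<subseteq> carrier G" "free_on_vertices (generate G S')" using S' by (auto simp: good_def)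
      then obtain c where c: "c \<in> carrier G" "c \<otimes> \<gamma> \<otimes> inv c \<notin> generate G S'"
        using conjugate_outside[OF _ _ _ v edges \<gamma> False] by blast
      then have "good (S', insert (c \<otimes> \<gamma> \<otimes> inv c) F)" using S' \<gamma> by (simp add: good_def)
      moreover have "treats x s (S', insert (c \<otimes> \<gamma> \<otimes> inv c) F)"
        using S' c(1) s_eq x_eq by (auto simp: treats_def)
      ultimately show ?thesis by blast
    qed
  qed

  have "\<exists>s. \<forall>n. good (s n) \<and> treats (from_nat_into items n) (s n) (s (Suc n))"
  proof (rule dependent_nat_choice)
    have "generate G {} = {\<one>}" by (rule generate_empty)
    then have "good ({}, {})" by (simp add: good_def free_on_vertices_def)
    then show "\<exists>s. good s" by blast
    show "\<exists>y. good y \<and> treats (from_nat_into items n) s y" if "good s" for s n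
      using step[OF that] from_nat_into[OF items_ne] by blast
  qed
  then obtain s where s: "\<And>n. good (s n)" "\<And>n. treats (from_nat_into items n) (s n) (s (Suc n))"
    by blast
  define S where "S n = fst (s n)" for n
  define F where "F n = snd (s n)" for n
  have good: "S n \<subseteq> carrier G" "F n \<inter> generate G (S n) = {}" for n
    using s(1)[of n] by (auto simp: good_def S_def F_def split: prod.splits)
  have suc: "S n \<subseteq> S (Suc n)" "F n \<subseteq> F (Suc n)" for n
    using s(2)[of n] by (auto simp: treats_def S_def F_def split: prod.splits)
  have mono: "S m \<subseteq> S n" "F m \<subseteq> F n" if "m \<le> n" for m n
    using lift_Suc_mono_le[of S m n] lift_Suc_mono_le[of F m n] suc that by auto
  define H where "H = (\<Union>n. generate G (S n))"
  have gen_mono: "generate G (S m) \<subseteq> generate G (S n)" if "m \<le> n" for m n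
    using mono_generate[OF mono(1)[OF that]] .
  \<comment> \<open>At the later of the two stages, both memberships would hold
    simultaneously.\<close>
  have F_H: "F n \<inter> H = {}" for n
  proof (rule ccontr)
    assume "F n \<inter> H \<noteq> {}"
    then obtain x m where "x \<in> F n" "x \<in> generate G (S m)" by (auto simp: H_def)
    then have "x \<in> F (max n m)" "x \<in> generate G (S (max n m))"
      using mono(2)[of n "max n m"] gen_mono[of m "max n m"] by auto
    then show False using good(2) by blast
  qed
  have subgroup: "subgroup H G"
  proof (rule subgroupI)
    show "H \<subseteq> carrier G" using generate_incl[OF good(1)] by (auto simp: H_def)
    show "H \<noteq> {}" using generate.one[of G "S 0"] by (auto simp: H_def)
    show "inv x \<in> H" if "x \<in> H" for x
      using that generate_m_inv_closed[OF good(1)] by (auto simp: H_def)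
    show "x \<otimes> y \<in> H" if xy: "x \<in> H" "y \<in> H" for x y
    proof -
      obtain m n where "x \<in> generate G (S m)" "y \<in> generate G (S n)" using xy by (auto simp: H_def)
      then have "x \<in> generate G (S (max m n))" "y \<in> generate G (S (max m n))"
        using gen_mono[of m "max m n"] gen_mono[of n "max m n"] by auto
      then show ?thesis unfolding H_def by (blast intro: generate.eng)
    qed
  qed
  have treated: "\<exists>n. treats x (S n, F n) (S (Suc n), F (Suc n))" if x: "x \<in> items" for x
  proof -
    obtain n where "from_nat_into items n = x" using from_nat_into_surj[OF items x] by blast
    then show ?thesis using s(2)[of n] by (auto simp: S_def F_def)
  qed
  show ?thesis
  proof (rule that[OF subgroup])
    fix \<gamma> assume \<gamma>: "\<gamma> \<in> carrier G" "\<gamma> \<noteq> \<one>"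
    then have "([], [], \<gamma>) \<in> items" by (simp add: items_def)
    then obtain n where "treats ([], [], \<gamma>) (S n, F n) (S (Suc n), F (Suc n))"
      using treated by blast
    then obtain c where "c \<in> carrier G" "c \<otimes> \<gamma> \<otimes> inv c \<in> F (Suc n)"
      using \<gamma>(2) by (auto simp: treats_def)
    then show "\<exists>c \<in> carrier G. c \<otimes> \<gamma> \<otimes> inv c \<notin> H" using F_H by blast
  next
    fix as bs :: "'g list"
    assume ab: "length as = length bs" "set as \<subseteq> carrier G" "set bs \<subseteq> carrier G"
      and sep: "\<And>i j. i < length as \<Longrightarrow> j < length as \<Longrightarrow> i \<noteq> j \<Longrightarrow> inv (as ! i) \<otimes> as ! j \<notin> H"
        "\<And>i j. i < length as \<Longrightarrow> j < length as \<Longrightarrow> i \<noteq> j \<Longrightarrow> inv (bs ! i) \<otimes> bs ! j \<notin> H"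
    have "(as, bs, \<one>) \<in> items" using ab by (auto simp: items_def in_lists_conv_set)
    then obtain n where n: "treats (as, bs, \<one>) (S n, F n) (S (Suc n), F (Suc n))" using treated by blast
    have "separated (generate G (S n)) as" "separated (generate G (S n)) bs"
      using sep ab(1) by (auto simp: separated_def H_def)
    then obtain g where "g \<in> carrier G"
      "\<forall>i < length as. inv (bs ! i) \<otimes> g \<otimes> as ! i \<in> generate G (S (Suc n))"
      using n unfolding treats_def by auto
    then show "\<exists>g \<in> carrier G. \<forall>i < length as. inv (bs ! i) \<otimes> g \<otimes> as ! i \<in> H"
      by (auto simp: H_def)
  qed
qed

end

section \<open>The action on left cosets\<close>

lemma (in group) l_coset_eq_iff:
  assumes H: "subgroup H G" and x: "x \<in> carrier G" and y: "y \<in> carrier G"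
  shows "x <# H = y <# H \<longleftrightarrow> inv y \<otimes> x \<in> H"
proof
  assume "x <# H = y <# H"
  moreover have "x \<in> x <# H" using subgroup.one_closed[OF H] x by (force simp: l_coset_def)
  ultimately obtain h where "h \<in> H" "x = y \<otimes> h" by (auto simp: l_coset_def)
  then show "inv y \<otimes> x \<in> H" using y subgroup.mem_carrier[OF H] by (simp add: mult_inv_cancel_left)
next
  assume "inv y \<otimes> x \<in> H"
  then have "x \<in> y <# H" using x y by (force simp: l_coset_def mult_inv_cancel_left)
  then show "x <# H = y <# H" using l_repr_independence[OF _ y H] by blast
qed

text \<open>On \<open>UNIV\<close> the extensionality demanded by \<open>Bij\<close> is vacuous and
  \<open>compose\<close> is ordinary composition.\<close>

lemma (in group) group_action_UNIV:
  assumes one: "\<alpha> \<one> = id"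
    and mult: "\<And>g h. \<lbrakk> g \<in> carrier G; h \<in> carrier G \<rbrakk> \<Longrightarrow> \<alpha> (g \<otimes> h) = \<alpha> g \<circ> \<alpha> h"
  shows "group_action G UNIV \<alpha>"
proof -
  have Bij: "\<alpha> g \<in> Bij UNIV" if "g \<in> carrier G" for g
  proof -
    have "\<alpha> g \<circ> \<alpha> (inv g) = id" "\<alpha> (inv g) \<circ> \<alpha> g = id"
      using that mult[of g "inv g"] mult[of "inv g" g] one by simp_all
    then show ?thesis by (auto simp: Bij_def extensional_def intro: o_bij)
  qed
  have "\<alpha> \<in> hom G (BijGroup UNIV)"
    using Bij mult by (auto simp: hom_def BijGroup_def compose_def)
  then show ?thesis
    unfolding group_action_def group_hom_def group_hom_axioms_def
    using is_group group_BijGroup by blast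
qed

text \<open>In \<open>trans\<close>, the conclusion says that \<open>g\<close> maps the coset of
  \<open>as ! i\<close> to that of \<open>bs ! i\<close>, and the hypotheses say that the cosets in
  each tuple are distinct. The condition \<open>core\<close> says that the kernel of the coset
  action is trivial.\<close>

lemma (in group) highly_transitive_action_of_subgroup:
  assumes count: "countable (carrier G)" and inf: "infinite (carrier G)" and H: "subgroup H G"
    and core: "\<And>\<gamma>. \<gamma> \<in> carrier G \<Longrightarrow> \<gamma> \<noteq> \<one> \<Longrightarrow> \<exists>c \<in> carrier G. c \<otimes> \<gamma> \<otimes> inv c \<notin> H"
    and trans: "\<And>as bs. \<lbrakk> length as = length bs; set as \<subseteq> carrier G; set bs \<subseteq> carrier G;
      \<And>i j. i < length as \<Longrightarrow> j < length as \<Longrightarrow> i \<noteq> j \<Longrightarrow> inv (as ! i) \<otimes> as ! j \<notin> H;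
      \<And>i j. i < length as \<Longrightarrow> j < length as \<Longrightarrow> i \<noteq> j \<Longrightarrow> inv (bs ! i) \<otimes> bs ! j \<notin> H \<rbrakk> \<Longrightarrow>
      \<exists>g \<in> carrier G. \<forall>i < length as. inv (bs ! i) \<otimes> g \<otimes> as ! i \<in> H"
  shows "\<exists>\<alpha>. faithful_action G (UNIV :: nat set) \<alpha> \<and> highly_transitive G (UNIV :: nat set) \<alpha>"
proof -
  define C where "C = (\<lambda>x. x <# H) ` carrier G"
  have HC: "H \<subseteq> carrier G" by (rule subgroup.subset[OF H])
  have shift: "g <# (x <# H) = (g \<otimes> x) <# H" if "g \<in> carrier G" "x \<in> carrier G" for g x
    using lcos_m_assoc[OF HC that] .
  have closed: "g <# c \<in> C" if "g \<in> carrier G" "c \<in> C" for g c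
    using that shift by (auto simp: C_def)
  have fixes_all: "g = \<one>" if g: "g \<in> carrier G" "\<And>c. c \<in> C \<Longrightarrow> g <# c = c" for g
  proof (rule ccontr)
    assume "g \<noteq> \<one>"
    then obtain c where c: "c \<in> carrier G" "c \<otimes> g \<otimes> inv c \<notin> H" using core g(1) by blast
    have "(g \<otimes> inv c) <# H = inv c <# H"
      using g c(1) shift[of g "inv c"] by (auto simp: C_def)
    then have "inv (inv c) \<otimes> (g \<otimes> inv c) \<in> H" using l_coset_eq_iff[OF H] g(1) c(1) by simp
    then show False using c g(1) by (simp add: m_assoc)
  qed
  have separate: "g = h" if "g \<in> carrier G" "h \<in> carrier G" and eq: "\<And>c. c \<in> C \<Longrightarrow> g <# c = h <# c" for g h
  proof -
    have "(inv h \<otimes> g) <# c = c" if c: "c \<in> C" for c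
    proof -
      obtain x where x: "x \<in> carrier G" "c = x <# H" using c by (auto simp: C_def)
      have "(inv h \<otimes> g) <# c = inv h <# (g <# c)"
        using \<open>g \<in> carrier G\<close> \<open>h \<in> carrier G\<close> x by (simp add: shift m_assoc)
      also have "\<dots> = inv h <# (h <# c)" using eq[OF c] by simp
      also have "\<dots> = c" using \<open>h \<in> carrier G\<close> x by (simp add: shift mult_inv_cancel_left)
      finally show ?thesis .
    qed
    then have "inv h \<otimes> g = \<one>" using fixes_all that by simp
    then show ?thesis using mult_inv_cancel_left(1)[of h g] that by simp
  qed
  \<comment> \<open>Otherwise the faithful action would embed the infinite group into the finite set
    of self-maps of \<open>C\<close>.\<close>
  have "infinite C"
  proof
    assume fin: "finite C"
    have "inj_on (\<lambda>g. \<lambda>c \<in> C. g <# c) (carrier G)"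
    proof (rule inj_onI)
      fix g h assume "g \<in> carrier G" "h \<in> carrier G" and eq: "(\<lambda>c \<in> C. g <# c) = (\<lambda>c \<in> C. h <# c)"
      moreover have "g <# c = h <# c" if "c \<in> C" for c
        using fun_cong[OF eq, of c] that by simp
      ultimately show "g = h" using separate by blast
    qed
    moreover have "(\<lambda>g. \<lambda>c \<in> C. g <# c) ` carrier G \<subseteq> C \<rightarrow>\<^sub>E C" using closed by auto
    ultimately show False
      using inf finite_PiE[OF fin, of "\<lambda>_. C"] fin by (meson finite_imageD finite_subset)
  qed
  moreover have "countable C" using count by (simp add: C_def)
  ultimately obtain \<beta> :: "'a set \<Rightarrow> nat" where \<beta>: "bij_betw \<beta> C UNIV"
    using countableE_infinite by blast
  define \<delta> where "\<delta> = inv_into C \<beta>"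
  have \<delta>: "\<delta> n \<in> C" "\<beta> (\<delta> n) = n" for n
    using \<beta> bij_betw_inv_into_right[OF \<beta>, of n] bij_betwE[OF bij_betw_inv_into[OF \<beta>]]
    by (auto simp: \<delta>_def)
  have \<delta>\<beta>: "\<delta> (\<beta> c) = c" if "c \<in> C" for c
    using bij_betw_inv_into_left[OF \<beta> that] by (simp add: \<delta>_def)
  \<comment> \<open>The enumeration of the cosets carries the action over to the natural
    numbers.\<close>
  define \<alpha> where "\<alpha> g n = \<beta> (g <# \<delta> n)" for g n
  have act: "group_action G UNIV \<alpha>"
  proof (rule group_action_UNIV)
    have "\<one> <# c = c" if "c \<in> C" for c
      using that shift[of \<one>] by (auto simp: C_def)
    then show "\<alpha> \<one> = id" using \<delta> by (auto simp: \<alpha>_def)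
    fix g h assume gh: "g \<in> carrier G" "h \<in> carrier G"
    have "(g \<otimes> h) <# c = g <# (h <# c)" if "c \<in> C" for c
      using that gh by (auto simp: C_def shift m_assoc)
    then show "\<alpha> (g \<otimes> h) = \<alpha> g \<circ> \<alpha> h" using \<delta> gh closed \<delta>\<beta> by (auto simp: \<alpha>_def)
  qed
  have "inj_on \<alpha> (carrier G)"
  proof (rule inj_onI)
    fix g h assume gh: "g \<in> carrier G" "h \<in> carrier G" and eq: "\<alpha> g = \<alpha> h"
    show "g = h"
    proof (rule separate[OF gh])
      fix c assume c: "c \<in> C"
      have "\<beta> (g <# c) = \<beta> (h <# c)" using fun_cong[OF eq, of "\<beta> c"] \<delta>\<beta>[OF c] by (simp add: \<alpha>_def)
      then show "g <# c = h <# c" using closed[OF gh(1) c] closed[OF gh(2) c] \<delta>\<beta> by metis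
    qed
  qed
  then have "faithful_action G UNIV \<alpha>"
    using act by (simp add: faithful_action_def faithful_action_axioms_def)
  moreover have "highly_transitive G UNIV \<alpha>"
    unfolding highly_transitive_def n_transitive_def
  proof (intro allI impI, elim conjE)
    fix n and xs ys :: "nat list"
    assume xy: "length xs = n" "distinct xs" "length ys = n" "distinct ys"
    define r where "r n = (SOME x. x \<in> carrier G \<and> \<delta> n = x <# H)" for n
    have r: "r n \<in> carrier G" "\<delta> n = r n <# H" for n
      using \<delta>(1)[of n] someI_ex[of "\<lambda>x. x \<in> carrier G \<and> \<delta> n = x <# H"] by (auto simp: r_def C_def)
    have r_inj: "inv (r k) \<otimes> r l \<notin> H" if "k \<noteq> l" for k l
      using l_coset_eq_iff[OF H r(1)[of l] r(1)[of k]] \<delta>(2) that r(2) by metis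
    have "\<exists>g \<in> carrier G. \<forall>i < length (map r xs). inv (map r ys ! i) \<otimes> g \<otimes> map r xs ! i \<in> H"
    proof (rule trans)
      show "length (map r xs) = length (map r ys)" using xy by simp
      show "set (map r xs) \<subseteq> carrier G" "set (map r ys) \<subseteq> carrier G" using r by auto
      show "inv (map r xs ! i) \<otimes> map r xs ! j \<notin> H" "inv (map r ys ! i) \<otimes> map r ys ! j \<notin> H"
        if "i < length (map r xs)" "j < length (map r xs)" "i \<noteq> j" for i j
        using that xy r_inj by (simp_all add: nth_eq_iff_index_eq)
    qed
    then obtain g where g: "g \<in> carrier G"
      "\<And>i. i < n \<Longrightarrow> inv (r (ys ! i)) \<otimes> g \<otimes> r (xs ! i) \<in> H" using xy by auto
    have "\<alpha> g (xs ! i) = ys ! i" if "i < n" for i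
    proof -
      have "g <# \<delta> (xs ! i) = (g \<otimes> r (xs ! i)) <# H" using r g(1) shift by simp
      also have "\<dots> = r (ys ! i) <# H"
        using g r by (simp add: l_coset_eq_iff[OF H] m_assoc[symmetric] that)
      finally show ?thesis using r(2) \<delta>(2) by (metis \<alpha>_def)
    qed
    then show "\<exists>g \<in> carrier G. \<forall>k < n. \<alpha> g (xs ! k) = ys ! k" using g(1) by blast
  qed
  ultimately show ?thesis by blast
qed

theorem theoremA:
  fixes G :: "('g, 'm) monoid_scheme"
    and T :: "('v, 'e) pre_digraph" and bar :: "'e \<Rightarrow> 'e"
    and \<phi> :: "'g \<Rightarrow> 'v \<Rightarrow> 'v" and \<psi> :: "'g \<Rightarrow> 'e \<Rightarrow> 'e"
  assumes "group G" and "countable (carrier G)"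
    and "serre_tree T bar" and "nontrivial_graph T"
    and "serre_graph_action G T bar \<phi> \<psi>" and "without_inversion G T bar \<psi>"
    and "\<And>v. v \<in> verts T \<Longrightarrow> icc (G\<lparr>carrier := stabilizer G \<phi> v\<rparr>)"
    and "\<And>e. e \<in> arcs T \<Longrightarrow> finite (stabilizer G \<psi> e)"
  shows "\<exists>(X :: nat set) \<alpha>. infinite X \<and> countable X \<and>
           faithful_action G X \<alpha> \<and> highly_transitive G X \<alpha>"
proof -
  interpret serre_tree_action G T bar \<phi> \<psi>
    using assms(1,3,5) by (intro serre_tree_action.intro)
  obtain f where f: "f \<in> arcs T" using assms(4) by (auto simp: nontrivial_graph_def)
  have "infinite (stabilizer G \<phi> (tail T f))" using assms(7)[of "tail T f"] f by (simp add: icc_def)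
  then have inf: "infinite (carrier G)"
    using finite_subset[OF vertex.stabilizer_subset] by blast
  obtain H where "subgroup H G"
    and "\<And>\<gamma>. \<gamma> \<in> carrier G \<Longrightarrow> \<gamma> \<noteq> \<one>\<^bsub>G\<^esub> \<Longrightarrow> \<exists>c \<in> carrier G. c \<otimes>\<^bsub>G\<^esub> \<gamma> \<otimes>\<^bsub>G\<^esub> inv\<^bsub>G\<^esub> c \<notin> H"
    and "\<And>as bs. \<lbrakk> length as = length bs; set as \<subseteq> carrier G; set bs \<subseteq> carrier G;
      \<And>i j. i < length as \<Longrightarrow> j < length as \<Longrightarrow> i \<noteq> j \<Longrightarrow> inv\<^bsub>G\<^esub> (as ! i) \<otimes>\<^bsub>G\<^esub> as ! j \<notin> H;
      \<And>i j. i < length as \<Longrightarrow> j < length as \<Longrightarrow> i \<noteq> j \<Longrightarrow> inv\<^bsub>G\<^esub> (bs ! i) \<otimes>\<^bsub>G\<^esub> bs ! j \<notin> H \<rbrakk> \<Longrightarrow>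
      \<exists>g \<in> carrier G. \<forall>i < length as. inv\<^bsub>G\<^esub> (bs ! i) \<otimes>\<^bsub>G\<^esub> g \<otimes>\<^bsub>G\<^esub> as ! i \<in> H"
    using exists_highly_transitive_core_free_subgroup[OF assms(2) f assms(8,7)] by blast
  then have "\<exists>\<alpha>. faithful_action G (UNIV :: nat set) \<alpha> \<and> highly_transitive G (UNIV :: nat set) \<alpha>"
    using highly_transitive_action_of_subgroup[OF assms(2) inf] by blast
  then show ?thesis by blast
qed

end
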